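(* Let $q\ge 2$ be an integer, let $T$ be the infinite $q$-ary tree rooted at $r$, and let $\varphi$ be the Gaussian kernel on $\mathbb{S}^1$ with parameter $\beta>0$ described in the context. If $q\,\lambda(\varphi)<1$, then the model has zero information flow, i.e. $\lim_{k\to\infty}\mathbb E[\mathrm{TV}(\mu_k,\sigma)]=0$.
   Context: Identify $\mathbb{S}^1$ with $[0,2\pi)$, let $\sigma$ be the uniform probability measure on it, and let $X\sim\mathcal N(0,\beta)$. The kernel $\varphi:\mathbb{S}^1\times\mathbb{S}^1\to\mathbb R$ is defined by: $\varphi(x,\cdot)$ is the density (with respect to $\sigma$) of $(x+X)\bmod 2\pi$. Define $\lambda(\varphi)=\int_{\mathbb{S}^1}\langle x,e_1\rangle\varphi(e_1,x)\,d\sigma(x)$, viewing points of $\mathbb{S}^1$ as unit vectors in $\mathbb R^2$. Labels on the tree: $g(r)$ is uniform on $\mathbb{S}^1$; iteratively, given the labels of all nodes at level $\ell$, the labels of the nodes at level $\ell+1$ are chosen independently, a child $u$ of $v$ having law $\varphi(g(v),\cdot)\,d\sigma$. $T_k$ is the set of nodes at depth $k$, and $\mu_k$ is the conditional distribution of $g(r)$ given $(g(v))_{v\in T_k}$. Zero information flow means $\lim_{k\to\infty}\mathbb E[\mathrm{TV}(\mu_k,\sigma)]=0$; positive information flow means this limit is positive. *)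

theory Defs
  imports "HOL-Probability.Probability"
begin

text \<open>The circle S1 is identified with [0, 2 pi) inside the reals; sigma is the uniform
probability measure on it (as a measure on the Borel reals, concentrated on [0,2 pi)).\<close>
definition sigmaS1 :: "real measure" where
  "sigmaS1 = uniform_measure lborel {0..<2*pi}"

text \<open>Wrapped Gaussian kernel: phi beta x y is the density w.r.t. sigma of (x + X) mod 2 pi,
X ~ N(0, beta) (beta is the variance, so the standard deviation is sqrt beta).
Lebesgue density on [0,2 pi) is the sum over n of the normal density at y - x + 2 pi n;
dividing by the sigma density 1/(2 pi) gives the factor 2 pi.\<close>
definition phi :: "real \<Rightarrow> real \<Rightarrow> real \<Rightarrow> real" where
  "phi \<beta> x y = 2 * pi * (\<Sum>\<^sub>\<infinity> n::int. normal_density 0 (sqrt \<beta>) (y - x + 2 * pi * of_int n))"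

text \<open>lambda(phi) = integral of <x, e1> phi(e1, x) d sigma(x); e1 is the angle 0, <x,e1> = cos x.\<close>
definition lambda_phi :: "real \<Rightarrow> real" where
  "lambda_phi \<beta> = (\<integral>x. cos x * phi \<beta> 0 x \<partial>sigmaS1)"

text \<open>Infinite q-ary tree: nodes are words over {0..<q}; the root is [], the children of v
are v @ [i], i < q; the parent of a non-root node u is butlast u.\<close>
definition nodes_upto :: "nat \<Rightarrow> nat \<Rightarrow> nat list set" where
  "nodes_upto q k = {v. length v \<le> k \<and> set v \<subseteq> {..<q}}"

definition level :: "nat \<Rightarrow> nat \<Rightarrow> nat list set" where
  "level q k = {v. length v = k \<and> set v \<subseteq> {..<q}}"

text \<open>Joint law of the labels (g(v)) of all nodes of depth at most k: root uniform, each
child independently with law phi(g(parent), .) d sigma given the previous level.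
This is the density of the broadcast process w.r.t. the product of the sigma's.\<close>
definition tree_law :: "nat \<Rightarrow> real \<Rightarrow> nat \<Rightarrow> (nat list \<Rightarrow> real) measure" where
  "tree_law q \<beta> k = density (PiM (nodes_upto q k) (\<lambda>_. sigmaS1))
     (\<lambda>g. \<Prod>v\<in>nodes_upto q k - {[]}. ennreal (phi \<beta> (g (butlast v)) (g v)))"

definition is_cond_distr ::
  "'w measure \<Rightarrow> ('w \<Rightarrow> 'a) \<Rightarrow> 'a measure \<Rightarrow> ('w \<Rightarrow> 'b) \<Rightarrow> 'b measure \<Rightarrow> ('b \<Rightarrow> 'a measure) \<Rightarrow> bool"
  where
  "is_cond_distr P X M Y N K \<longleftrightarrow>
     K \<in> N \<rightarrow>\<^sub>M prob_algebra M \<and>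
     (\<forall>A\<in>sets M. \<forall>B\<in>sets N.
        measure P {\<omega>\<in>space P. X \<omega> \<in> A \<and> Y \<omega> \<in> B}
          = (\<integral>\<omega>. indicator B (Y \<omega>) * measure (K (Y \<omega>)) A \<partial>P))"

definition tv_dist :: "'a measure \<Rightarrow> 'a measure \<Rightarrow> real" where
  "tv_dist M N = (SUP A\<in>sets M. \<bar>measure M A - measure N A\<bar>)"

end

theory Submission
  imports Defs "HOL-Real_Asymp.Real_Asymp"
begin

text \<open>
  Measure distances on the circle by the chord \<open>d(a, b) = \<bar>sin ((a - b) / 2)\<bar>\<close>. Reflecting one of two
  Brownian motions about the midpoint of their starting points, until they meet, makes the expected
  chord distance decay exactly like \<open>exp (- t / 2)\<close>, because \<open>sin (\<theta> / 2)\<close> is an eigenfunction for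
  the angular difference. Hence the kernel contracts chord-Lipschitz constants by the factor
  \<open>\<lambda>(\<phi>) = exp (- \<beta> / 2)\<close>. Analytically the reflection argument is an inequality between integrals of
  odd functions on the real line; it is only approximately valid on the circle, with an error that is
  superpolynomially small in \<open>t\<close>, so it is applied to \<open>n\<close> steps of variance \<open>\<beta> / n\<close> and
  \<open>n \<rightarrow> \<infinity>\<close>.

  One level of the tree smooths a bounded function of the leaves into a Lipschitz one, and each further
  level multiplies the Lipschitz constant (for the sum of the chords over a level) by at most
  \<open>q \<lambda>(\<phi>)\<close>. So the laws of the leaves given two different root labels differ in total variation by
  \<open>O((q \<lambda>(\<phi>)) ^ k)\<close>, and the expected total variation distance between the posterior of the
  root and its prior is at most the average of these differences.
\<close>

section \<open>Gaussian averages of periodic functions\<close>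

text \<open>The chord uses the half angle so that \<open>m + s\<close> and \<open>m - s\<close> are
  at distance \<open>\<bar>sin s\<bar>\<close>; this is where the sine enters. The obstacle is the
  absolute value: on the line the eigenfunction is \<open>sin s\<close>, which turns negative after
  \<open>pi\<close>, so it dominates the increments of a Lipschitz function only up to there. A jump
  at \<open>pi\<close> restores the domination and is charged only for the Gaussian density at
  distance \<open>pi / 2\<close>.

  Lipschitz constants refer to a sum over nodes because a sum, unlike a maximum, can be treated one
  coordinate at a time, for functions with any joint dependence on the labels.

  The posterior is given only as some version of a conditional distribution, arbitrary on null sets.
  Bayes' formula must first be recovered for it off one null set that serves all Borel sets
  simultaneously, since the total variation distance is a supremum over all of them.\<close>

definition gauss_avg :: "real \<Rightarrow> (real \<Rightarrow> real) \<Rightarrow> real \<Rightarrow> real" where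
  "gauss_avg t h x = (\<integral>s. normal_density 0 (sqrt t) s * h (x + s) \<partial>lborel)"

lemma normal_density_minus: "normal_density 0 \<sigma> (- s) = normal_density 0 \<sigma> s"
  by (simp add: normal_density_def)

lemma normal_density_antimono:
  assumes "\<bar>a\<bar> \<le> \<bar>b\<bar>"
  shows "normal_density 0 \<sigma> b \<le> normal_density 0 \<sigma> a"
proof -
  have "a\<^sup>2 \<le> b\<^sup>2" using assms by (simp add: abs_le_square_iff)
  then have "- b\<^sup>2 / (2 * \<sigma>\<^sup>2) \<le> - a\<^sup>2 / (2 * \<sigma>\<^sup>2)"
    by (intro divide_right_mono) auto
  then show ?thesis
    unfolding normal_density_def by (intro mult_left_mono) auto
qed

lemma integrable_mult_bounded:
  fixes f h :: "'a \<Rightarrow> real"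
  assumes "integrable M f" "h \<in> borel_measurable M" "\<And>s. s \<in> space M \<Longrightarrow> \<bar>h s\<bar> \<le> B"
  shows "integrable M (\<lambda>s. f s * h s)"
proof (rule Bochner_Integration.integrable_bound)
  show "integrable M (\<lambda>s. B * f s)" using assms(1) by simp
  show "(\<lambda>s. f s * h s) \<in> borel_measurable M"
    using assms(1,2) by measurable
  show "AE s in M. norm (f s * h s) \<le> norm (B * f s)"
  proof (rule AE_I2)
    fix s assume "s \<in> space M"
    then have "\<bar>h s\<bar> \<le> \<bar>B\<bar>" using assms(3)[of s] by linarith
    then show "norm (f s * h s) \<le> norm (B * f s)"
      by (simp add: abs_mult mult.commute[of "\<bar>f s\<bar>"] mult_right_mono)
  qed
qed

lemma integrable_gauss_mult:
  assumes "t > 0" "h \<in> borel_measurable borel" "\<And>s. \<bar>h s\<bar> \<le> B"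
  shows "integrable lborel (\<lambda>s. normal_density 0 (sqrt t) (s - a) * h (s + b))"
proof (rule integrable_mult_bounded[where B=B])
  have "integrable lborel (\<lambda>s. normal_density 0 (sqrt t) (- a + 1 * s))"
    by (rule lborel_integrable_real_affine) (use assms in auto)
  then show "integrable lborel (\<lambda>s. normal_density 0 (sqrt t) (s - a))"
    by (simp add: algebra_simps)
  show "(\<lambda>s. h (s + b)) \<in> borel_measurable lborel"
    using assms(2) by measurable
qed (use assms in auto)

lemma integrable_gauss_avg:
  assumes "t > 0" "h \<in> borel_measurable borel" "\<And>s. \<bar>h s\<bar> \<le> B"
  shows "integrable lborel (\<lambda>s. normal_density 0 (sqrt t) s * h (x + s))"
  using integrable_gauss_mult[OF assms, of 0 x] by (simp add: add.commute)

lemma gauss_avg_shift: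
  "gauss_avg t h x = (\<integral>s. normal_density 0 (sqrt t) (s - x) * h s \<partial>lborel)"
  unfolding gauss_avg_def
  by (subst (2) lborel_integral_real_affine[where c=1 and t=x]) (auto simp: algebra_simps)

lemma gauss_avg_reflect:
  "gauss_avg t h x = gauss_avg t (\<lambda>s. h (- s)) (- x)"
  unfolding gauss_avg_def
  by (subst lborel_integral_real_affine[where c="-1" and t=0]) (auto simp: normal_density_minus)

lemma gauss_avg_diff:
  assumes "t > 0" "h \<in> borel_measurable borel" "\<And>s. \<bar>h s\<bar> \<le> B"
    "k \<in> borel_measurable borel" "\<And>s. \<bar>k s\<bar> \<le> C"
  shows "gauss_avg t (\<lambda>s. h s - k s) x = gauss_avg t h x - gauss_avg t k x"
  unfolding gauss_avg_def right_diff_distrib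
  by (rule Bochner_Integration.integral_diff[OF integrable_gauss_avg integrable_gauss_avg])
    (use assms in auto)

lemma gauss_avg_add:
  assumes "t > 0" "h \<in> borel_measurable borel" "\<And>s. \<bar>h s\<bar> \<le> B"
    "k \<in> borel_measurable borel" "\<And>s. \<bar>k s\<bar> \<le> C"
  shows "gauss_avg t (\<lambda>s. h s + k s) x = gauss_avg t h x + gauss_avg t k x"
  unfolding gauss_avg_def distrib_left
  by (rule Bochner_Integration.integral_add[OF integrable_gauss_avg integrable_gauss_avg])
    (use assms in auto)

lemma gauss_avg_cmult: "gauss_avg t (\<lambda>s. c * h s) x = c * gauss_avg t h x"
  unfolding gauss_avg_def by (simp add: mult.left_commute[of _ c])

lemma gauss_avg_translate: "gauss_avg t (\<lambda>s. h (a + s)) x = gauss_avg t h (a + x)"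
  unfolding gauss_avg_def by (simp add: add.assoc)

text \<open>The reflection principle: the kernel on the right-hand side is odd in \<open>s\<close> and nonnegative for
  \<open>s \<ge> 0\<close> and \<open>\<delta> \<ge> 0\<close>.\<close>
lemma gauss_avg_odd:
  assumes "t > 0" "h \<in> borel_measurable borel" "\<And>s. \<bar>h s\<bar> \<le> B" "\<And>s. h (- s) = - h s"
  shows "integrable lborel (\<lambda>s. (normal_density 0 (sqrt t) (s - \<delta>) - normal_density 0 (sqrt t) (s + \<delta>)) * h s)"
    and "2 * gauss_avg t h \<delta>
      = (\<integral>s. (normal_density 0 (sqrt t) (s - \<delta>) - normal_density 0 (sqrt t) (s + \<delta>)) * h s \<partial>lborel)"
proof -
  note i = integrable_gauss_mult[OF assms(1-3), of \<delta> 0] integrable_gauss_mult[OF assms(1-3), of "-\<delta>" 0]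
  show "integrable lborel (\<lambda>s. (normal_density 0 (sqrt t) (s - \<delta>) - normal_density 0 (sqrt t) (s + \<delta>)) * h s)"
    using Bochner_Integration.integrable_diff[OF i] by (simp add: left_diff_distrib)
  have "gauss_avg t h \<delta> = gauss_avg t (\<lambda>s. - 1 * h s) (- \<delta>)"
    by (subst gauss_avg_reflect) (simp add: assms(4))
  also have "\<dots> = - gauss_avg t h (- \<delta>)"
    by (subst gauss_avg_cmult) simp
  finally have "2 * gauss_avg t h \<delta> = gauss_avg t h \<delta> - gauss_avg t h (- \<delta>)" by simp
  also have "\<dots> = (\<integral>s. (normal_density 0 (sqrt t) (s - \<delta>) - normal_density 0 (sqrt t) (s + \<delta>)) * h s \<partial>lborel)"
    using Bochner_Integration.integral_diff[OF i]
    by (simp add: gauss_avg_shift left_diff_distrib)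
  finally show "2 * gauss_avg t h \<delta>
      = (\<integral>s. (normal_density 0 (sqrt t) (s - \<delta>) - normal_density 0 (sqrt t) (s + \<delta>)) * h s \<partial>lborel)" .
qed

text \<open>This replaces the reflection coupling: \<open>K\<close> and \<open>u\<close> are both
  odd, so \<open>K s * u s\<close> is even, and a comparison on \<open>s \<ge> 0\<close>, where
  \<open>K\<close> is nonnegative, carries over to the whole line.\<close>

lemma gauss_avg_odd_mono:
  assumes "t > 0" "\<delta> \<ge> 0"
    and u: "u \<in> borel_measurable borel" "\<And>s. \<bar>u s\<bar> \<le> B" "\<And>s. u (- s) = - u s"
    and w: "w \<in> borel_measurable borel" "\<And>s. \<bar>w s\<bar> \<le> C" "\<And>s. w (- s) = - w s"
    and uw: "\<And>s. s \<ge> 0 \<Longrightarrow> \<bar>u s\<bar> \<le> w s"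
  shows "\<bar>gauss_avg t u \<delta>\<bar> \<le> gauss_avg t w \<delta>"
proof -
  define K where "K s = normal_density 0 (sqrt t) (s - \<delta>) - normal_density 0 (sqrt t) (s + \<delta>)" for s
  have K0: "K s \<ge> 0" if "s \<ge> 0" for s
    using normal_density_antimono[of "s - \<delta>" "s + \<delta>"] that assms(2) by (auto simp: K_def)
  have Kodd: "K (- s) = - K s" for s
  proof -
    have "- s - \<delta> = - (s + \<delta>)" "- s + \<delta> = - (s - \<delta>)" by auto
    then show ?thesis by (simp only: K_def normal_density_minus)
  qed
  have pt: "\<bar>K s * u s\<bar> \<le> K s * w s" for s
  proof (cases "s \<ge> 0")
    case True
    then show ?thesis using K0[of s] uw[of s] by (auto simp: abs_mult intro: mult_left_mono)
  next
    case False
    then have "\<bar>K (- s) * u (- s)\<bar> \<le> K (- s) * w (- s)"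
      using K0[of "- s"] uw[of "- s"] by (auto simp: abs_mult intro: mult_left_mono)
    then show ?thesis using Kodd u(3) w(3) by (simp add: abs_mult)
  qed
  have "\<bar>2 * gauss_avg t u \<delta>\<bar> = \<bar>\<integral>s. K s * u s \<partial>lborel\<bar>"
    using gauss_avg_odd(2)[OF assms(1) u] by (simp add: K_def)
  also have "\<dots> \<le> (\<integral>s. \<bar>K s * u s\<bar> \<partial>lborel)" by (rule integral_abs_bound)
  also have "\<dots> \<le> (\<integral>s. K s * w s \<partial>lborel)"
    using gauss_avg_odd(1)[OF assms(1) u] gauss_avg_odd(1)[OF assms(1) w] pt
    by (intro integral_mono) (auto simp: K_def)
  also have "\<dots> = 2 * gauss_avg t w \<delta>"
    using gauss_avg_odd(2)[OF assms(1) w] by (simp add: K_def)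
  finally show ?thesis by simp
qed

text \<open>The strict inequalities serve the case \<open>a = 0\<close>, in which this is the sign
  function, with value 0 at 0 as oddness demands. The other case in use is
  \<open>a = pi\<close>.\<close>

definition odd_step :: "real \<Rightarrow> real \<Rightarrow> real" where
  "odd_step a s = of_bool (s > 0 \<and> s \<ge> a) - of_bool (s < 0 \<and> s \<le> - a)"

lemma odd_step_props:
  shows "odd_step a \<in> borel_measurable borel" "\<bar>odd_step a s\<bar> \<le> 1" "odd_step a (- s) = - odd_step a s"
proof -
  show "odd_step a \<in> borel_measurable borel" unfolding odd_step_def[abs_def] by measurable
qed (auto simp: odd_step_def)

text \<open>By oddness the average is half the difference of the averages at \<open>\<delta>\<close>
  and \<open>- \<delta>\<close>. Moving the step by \<open>2 * \<delta>\<close> changes its value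
  only near the two jumps, on intervals of length \<open>2 * \<delta>\<close> in which
  \<open>\<bar>s\<bar> \<ge> a - \<delta>\<close> and hence the density is at most \<open>M\<close>.
  For \<open>a = 0\<close> the two intervals coincide and account for a jump by 2.\<close>

lemma gauss_avg_odd_step:
  assumes "t > 0" "\<delta> \<ge> 0" "a \<ge> 0" and M: "\<And>s. a - \<delta> \<le> \<bar>s\<bar> \<Longrightarrow> normal_density 0 (sqrt t) s \<le> M"
  shows "gauss_avg t (odd_step a) \<delta> \<le> 2 * \<delta> * M"
proof -
  let ?G = "normal_density 0 (sqrt t)"
  have i: "integrable lborel (\<lambda>s. ?G s * odd_step a (x + s))" for x
    by (rule integrable_gauss_avg[OF assms(1) odd_step_props(1,2)])
  have "gauss_avg t (odd_step a) \<delta> = gauss_avg t (\<lambda>s. - 1 * odd_step a s) (- \<delta>)"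
    by (subst gauss_avg_reflect) (simp add: odd_step_props(3))
  also have "\<dots> = - gauss_avg t (odd_step a) (- \<delta>)"
    by (subst gauss_avg_cmult) simp
  finally have "2 * gauss_avg t (odd_step a) \<delta>
      = gauss_avg t (odd_step a) \<delta> - gauss_avg t (odd_step a) (- \<delta>)" by simp
  also have "\<dots> = (\<integral>s. ?G s * odd_step a (\<delta> + s) - ?G s * odd_step a (- \<delta> + s) \<partial>lborel)"
    unfolding gauss_avg_def using i by (intro Bochner_Integration.integral_diff[symmetric])
  also have "\<dots> \<le> (\<integral>s. M * indicator {a - \<delta>..a + \<delta>} s + M * indicator {- a - \<delta>..- a + \<delta>} s \<partial>lborel)"
  proof (rule integral_mono)
    show "integrable lborel (\<lambda>s. ?G s * odd_step a (\<delta> + s) - ?G s * odd_step a (- \<delta> + s))"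
      using i[of \<delta>] i[of "- \<delta>"] by (rule Bochner_Integration.integrable_diff)
    show "integrable lborel (\<lambda>s. M * indicator {a - \<delta>..a + \<delta>} s + M * indicator {- a - \<delta>..- a + \<delta>} s)"
      by (intro Bochner_Integration.integrable_add integrable_mult_right integrable_real_indicator) (use assms(2) in \<open>auto simp: emeasure_lborel_Icc_eq\<close>)
    fix s
    have "?G s * (odd_step a (\<delta> + s) - odd_step a (- \<delta> + s))
      \<le> ?G s * (indicator {a - \<delta>..a + \<delta>} s + indicator {- a - \<delta>..- a + \<delta>} s)"
      using assms(2,3) by (intro mult_left_mono) (auto simp: odd_step_def indicator_def)
    also have "\<dots> \<le> M * (indicator {a - \<delta>..a + \<delta>} s + indicator {- a - \<delta>..- a + \<delta>} s)"
      using M[of s] by (auto simp: indicator_def)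
    finally show "?G s * odd_step a (\<delta> + s) - ?G s * odd_step a (- \<delta> + s)
      \<le> M * indicator {a - \<delta>..a + \<delta>} s + M * indicator {- a - \<delta>..- a + \<delta>} s"
      by (simp add: algebra_simps)
  qed
  also have "\<dots> = (\<integral>s. M * indicator {a - \<delta>..a + \<delta>} s \<partial>lborel) + (\<integral>s. M * indicator {- a - \<delta>..- a + \<delta>} s \<partial>lborel)"
    by (intro Bochner_Integration.integral_add integrable_mult_right integrable_real_indicator) (use assms(2) in \<open>auto simp: emeasure_lborel_Icc_eq\<close>)
  also have "\<dots> = 4 * \<delta> * M" using assms(2) by simp
  finally show ?thesis by (simp add: mult_ac)
qed

section \<open>Trigonometric eigenfunctions of the Gaussian average\<close>

lemma gauss_avg_cos_0:
  assumes "t > 0"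
  shows "gauss_avg t cos 0 = exp (- t / 2)"
proof -
  have "gauss_avg t cos 0 = (\<integral>s. std_normal_density s * cos (sqrt t * s) \<partial>lborel)"
  proof -
    have "sqrt t * normal_density 0 (sqrt t) (sqrt t * s) = std_normal_density s" for s
      using assms by (simp add: normal_density_def power_mult_distrib real_sqrt_mult)
    then have scale: "sqrt t * (normal_density 0 (sqrt t) (sqrt t * s) * cos (sqrt t * s)) = std_normal_density s * cos (sqrt t * s)" for s
      by (simp only: mult.assoc[symmetric])
    have "gauss_avg t cos 0 = sqrt t * (\<integral>s. normal_density 0 (sqrt t) (sqrt t * s) * cos (sqrt t * s) \<partial>lborel)"
      using lborel_integral_real_affine[of "sqrt t" "\<lambda>s. normal_density 0 (sqrt t) s * cos s" 0] assms
      by (simp add: gauss_avg_def)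
    also have "\<dots> = (\<integral>s. sqrt t * (normal_density 0 (sqrt t) (sqrt t * s) * cos (sqrt t * s)) \<partial>lborel)"
      by (rule integral_mult_right_zero[symmetric])
    finally show ?thesis by (simp only: scale)
  qed
  also have "\<dots> = (\<integral>s. cos (sqrt t * s) \<partial>std_normal_distribution)"
    by (subst integral_density) auto
  also have "\<dots> = (\<integral>s. Re (iexp (sqrt t * s)) \<partial>std_normal_distribution)"
    by (simp add: Re_exp)
  also have "\<dots> = Re (char std_normal_distribution (sqrt t))"
  proof -
    interpret real_distribution std_normal_distribution by (rule real_dist_normal_dist)
    show ?thesis unfolding char_def by (intro integral_Re integrable_iexp) auto
  qed
  also have "\<dots> = exp (- t / 2)"
    using assms by (simp add: char_std_normal_distribution flip: of_real_exp)
  finally show ?thesis .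
qed

lemma gauss_avg_odd_0:
  assumes "\<And>s. h (- s) = - h s"
  shows "gauss_avg t h 0 = 0"
proof -
  have "gauss_avg t h 0 = gauss_avg t (\<lambda>s. - 1 * h s) 0"
    by (subst gauss_avg_reflect) (simp add: assms)
  then show ?thesis by (subst (asm) gauss_avg_cmult) simp
qed

text \<open>In the addition theorem the odd part averages to 0, so the eigenvalue is the mean of
  \<open>cos\<close> under the centred normal law: the same number as
  \<open>lambda_phi\<close>.\<close>

lemma gauss_avg_sin:
  assumes "t > 0"
  shows "gauss_avg t sin x = exp (- t / 2) * sin x"
proof -
  have "gauss_avg t sin x = gauss_avg t (\<lambda>s. sin x * cos s + cos x * sin s) 0"
    using gauss_avg_translate[of t sin x 0] by (simp add: sin_add)
  also have "\<dots> = sin x * gauss_avg t cos 0 + cos x * gauss_avg t sin 0"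
    using assms
    by (subst gauss_avg_add[where B=1 and C=1])
      (auto simp: gauss_avg_cmult abs_mult intro!: mult_le_one)
  finally show ?thesis using assms by (simp add: gauss_avg_cos_0 gauss_avg_odd_0)
qed

text \<open>Half the Euclidean distance of the unit vectors at the angles \<open>a\<close> and
  \<open>b\<close>, hence well defined modulo full turns and at most 1.\<close>

definition chord :: "real \<Rightarrow> real \<Rightarrow> real" where
  "chord a b = \<bar>sin ((a - b) / 2)\<bar>"

lemma chord_props: "chord a b \<ge> 0" "chord a b \<le> 1" "chord a a = 0" "chord a b = chord b a"
  using sin_minus[of "(a - b) / 2"] by (auto simp: chord_def minus_divide_left)

lemma chord_period: "chord (a + 2 * pi * of_int n) a = 0"
  by (simp add: chord_def sin_npi_int)

lemma chord_eq_mod: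
  "chord (a + 2 * pi * of_int n) b = chord a b"
proof -
  have "(a + 2 * pi * of_int n - b) / 2 = (a - b) / 2 + pi * of_int n" by (simp add: field_simps)
  then have "sin ((a + 2 * pi * of_int n - b) / 2) = sin ((a - b) / 2) * cos (pi * of_int n)"
    by (simp only: sin_add) (simp add: sin_npi_int)
  then show ?thesis by (simp add: chord_def cos_npi_int abs_mult)
qed

text \<open>Two points of the circle lie symmetrically about the midpoint \<open>m\<close> of the
  shorter arc between them, at an angle of at most \<open>pi / 2\<close> from it. In this range
  \<open>sin \<delta>\<close> is nonnegative and comparable with \<open>\<delta>\<close>.\<close>

lemma circle_pair_wlog:
  fixes P :: "real \<Rightarrow> real \<Rightarrow> bool"
  assumes sym: "\<And>a b. P a b \<Longrightarrow> P b a"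
    and per: "\<And>a b n::int. P a b \<Longrightarrow> P (a + 2 * pi * of_int n) b"
    and base: "\<And>m \<delta>. 0 \<le> \<delta> \<Longrightarrow> \<delta> \<le> pi / 2 \<Longrightarrow> P (m + \<delta>) (m - \<delta>)"
  shows "P a b"
proof -
  define n where "n = \<lfloor>(a - b) / (2 * pi)\<rfloor>"
  define r where "r = a - b - 2 * pi * of_int n"
  have "of_int n \<le> (a - b) / (2 * pi)" "(a - b) / (2 * pi) < of_int n + 1"
    unfolding n_def by linarith+
  then have r: "0 \<le> r" "r < 2 * pi"
    by (simp_all add: r_def field_simps)
  show ?thesis
  proof (cases "r \<le> pi")
    case True
    then have "P (b + r / 2 + r / 2) (b + r / 2 - r / 2)" using r by (intro base) auto
    then have "P (b + r) b" by (simp only: add_diff_cancel_right' add.assoc field_sum_of_halves)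
    then have "P (b + r + 2 * pi * of_int n) b" by (rule per)
    then show ?thesis by (simp add: r_def)
  next
    case False
    \<comment> \<open>Now the shorter arc leads from \<open>b\<close> downwards: its midpoint is
      \<open>b - \<delta>\<close>, its other end is \<open>a\<close> up to \<open>n + 1\<close>
      turns, and the base case yields the pair in the opposite order.\<close>
    define \<delta> where "\<delta> = (2 * pi - r) / 2"
    have "P (b - \<delta> + \<delta>) (b - \<delta> - \<delta>)" using r False by (intro base) (auto simp: \<delta>_def)
    then have "P (b - 2 * \<delta> + 2 * pi * of_int (n + 1)) b" by (intro per, intro sym[of b]) (simp add: algebra_simps)
    moreover have "b - 2 * \<delta> + 2 * pi * of_int (n + 1) = a"
      by (simp add: r_def \<delta>_def field_simps)
    ultimately show ?thesis by simp
  qed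
qed

text \<open>A difference at two points becomes a single average of an odd function, the form that
  \<open>gauss_avg_odd_mono\<close> compares.\<close>

lemma gauss_avg_antisym:
  assumes "t > 0" "h \<in> borel_measurable borel" "\<And>s. \<bar>h s\<bar> \<le> B"
  shows "gauss_avg t (\<lambda>s. h (m + s) - h (m - s)) \<delta> = gauss_avg t h (m + \<delta>) - gauss_avg t h (m - \<delta>)"
proof -
  have "gauss_avg t (\<lambda>s. h (m - s)) \<delta> = gauss_avg t (\<lambda>s. h (m + s)) (- \<delta>)"
    by (subst gauss_avg_reflect) simp
  then have *: "gauss_avg t (\<lambda>s. h (m - s)) \<delta> = gauss_avg t h (m - \<delta>)"
    by (simp add: gauss_avg_translate)
  have "gauss_avg t (\<lambda>s. h (m + s) - h (m - s)) \<delta>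
     = gauss_avg t (\<lambda>s. h (m + s)) \<delta> - gauss_avg t (\<lambda>s. h (m - s)) \<delta>"
    using assms by (intro gauss_avg_diff[where B=B and C=B]) auto
  then show ?thesis by (simp add: * gauss_avg_translate)
qed

lemma gauss_avg_periodic:
  assumes "\<And>s n. h (s + 2 * pi * of_int n) = h s"
  shows "gauss_avg t h (x + 2 * pi * of_int n) = gauss_avg t h x"
proof -
  have "h (x + 2 * pi * of_int n + s) = h (x + s)" for s
    using assms[of "x + s" n] by (simp add: add_ac)
  then show ?thesis by (simp add: gauss_avg_def)
qed

section \<open>Contraction and smoothing by a single Gaussian step\<close>

lemma chord_lipschitz_periodic:
  assumes "\<And>a b. \<bar>h a - h b\<bar> \<le> c * chord a b"
  shows "h (s + 2 * pi * of_int n) = (h s :: real)"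
  using assms[of "s + 2 * pi * of_int n" s] by (simp add: chord_period)

lemma chord_lipschitz_bounded:
  assumes "\<And>a b. \<bar>h a - h b\<bar> \<le> c * chord a b"
  shows "c \<ge> 0" "\<bar>h s\<bar> \<le> \<bar>h 0\<bar> + (c :: real)"
proof -
  have "0 \<le> \<bar>h pi - h 0\<bar>" by simp
  also have "\<dots> \<le> c" using assms[of pi 0] by (simp add: chord_def)
  finally show c: "c \<ge> 0" .
  have "\<bar>h s - h 0\<bar> \<le> c * 1"
    using assms[of s 0] mult_left_mono[OF chord_props(2)[of s 0] c] by linarith
  then show "\<bar>h s\<bar> \<le> \<bar>h 0\<bar> + c" by linarith
qed

text \<open>Jordan's inequality: the graph of \<open>sin\<close>, concave on this interval, lies
  above its secant.\<close>

lemma le_half_pi_sin: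
  assumes "0 \<le> x" "x \<le> pi / 2"
  shows "x \<le> pi / 2 * sin x"
proof -
  have "concave_on {0..pi / 2} sin"
    unfolding concave_on_def
  proof (rule f''_ge0_imp_convex)
    show "((\<lambda>x. - sin x) has_real_derivative - cos x) (at x)" for x :: real
      by (auto intro!: derivative_eq_intros)
    show "((\<lambda>x. - cos x) has_real_derivative sin x) (at x)" for x :: real
      by (auto intro!: derivative_eq_intros)
    show "0 \<le> sin x" if "x \<in> {0..pi / 2}" for x :: real
      using that by (intro sin_ge_zero) auto
  qed auto
  from concave_onD_Icc'[OF this, of x] show ?thesis
    using assms pi_gt_zero by (simp add: field_simps)
qed

text \<open>Origin of the error term: the jump of height \<open>2 * c\<close> contributes at most
  \<open>2 * c * (2 * \<delta> * ?M)\<close>. The density is taken at \<open>pi / 2\<close> because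
  \<open>\<bar>s\<bar> \<ge> pi - \<delta> \<ge> pi / 2\<close> near the jump, and
  \<open>\<delta> \<le> pi / 2 * sin \<delta>\<close> turns \<open>\<delta>\<close> back into a
  chord.\<close>

lemma gauss_avg_contract_step:
  assumes "t > 0" and h: "h \<in> borel_measurable borel" "\<And>a b. \<bar>h a - h b\<bar> \<le> c * chord a b"
  shows "\<bar>gauss_avg t h a - gauss_avg t h b\<bar>
    \<le> c * (exp (- t / 2) + 2 * pi * normal_density 0 (sqrt t) (pi / 2)) * chord a b"
proof (rule circle_pair_wlog[of "\<lambda>a b. \<bar>gauss_avg t h a - gauss_avg t h b\<bar>
    \<le> c * (exp (- t / 2) + 2 * pi * normal_density 0 (sqrt t) (pi / 2)) * chord a b" a b])
  note per = gauss_avg_periodic[of h, OF chord_lipschitz_periodic[OF h(2)]]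
  note bd = chord_lipschitz_bounded[OF h(2)]
  let ?M = "normal_density 0 (sqrt t) (pi / 2)"
  fix m \<delta> :: real assume \<delta>: "0 \<le> \<delta>" "\<delta> \<le> pi / 2"
  \<comment> \<open>The odd eigenfunction \<open>c * sin s\<close> dominates the increment \<open>h (m + s) - h (m - s)\<close> only up to
    \<open>\<pi>\<close>; the step term repairs this beyond \<open>\<pi>\<close>, where hardly any mass lives.\<close>
  define w where "w s = c * sin s + (2 * c) * odd_step pi s" for s
  have sin0: "sin \<delta> \<ge> 0" using \<delta> by (intro sin_ge_zero) auto
  have "\<bar>gauss_avg t h (m + \<delta>) - gauss_avg t h (m - \<delta>)\<bar> = \<bar>gauss_avg t (\<lambda>s. h (m + s) - h (m - s)) \<delta>\<bar>"
    using gauss_avg_antisym[OF assms(1,2) bd(2)] by simp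
  also have "\<dots> \<le> gauss_avg t w \<delta>"
  proof (rule gauss_avg_odd_mono)
    show "(\<lambda>s. h (m + s) - h (m - s)) \<in> borel_measurable borel" using h(1) by measurable
    show "\<bar>h (m + s) - h (m - s)\<bar> \<le> c" for s
      using h(2)[of "m + s" "m - s"] mult_left_mono[OF chord_props(2)[of "m + s" "m - s"] bd(1)] by linarith
    show "w \<in> borel_measurable borel" unfolding w_def[abs_def] using odd_step_props(1) by measurable
    have "\<bar>w s\<bar> \<le> c * \<bar>sin s\<bar> + 2 * c * \<bar>odd_step pi s\<bar>" for s
      unfolding w_def using bd(1) by (intro order_trans[OF abs_triangle_ineq]) (simp add: abs_mult)
    also have "\<dots> s \<le> c * 1 + 2 * c * 1" for s
      using bd(1) odd_step_props(2)[of pi s] by (intro add_mono mult_left_mono) auto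
    finally show "\<bar>w s\<bar> \<le> 3 * c" for s by simp
    show "w (- s) = - w s" for s by (simp add: w_def odd_step_props(3))
    fix s :: real assume s: "s \<ge> 0"
    have "\<bar>h (m + s) - h (m - s)\<bar> \<le> c * \<bar>sin s\<bar>"
      using h(2)[of "m + s" "m - s"] by (simp add: chord_def)
    also have "c * \<bar>sin s\<bar> \<le> c * (sin s + 2 * odd_step pi s)"
    proof (intro mult_left_mono bd(1))
      \<comment> \<open>Between 0 and \<open>pi\<close> the difference
        \<open>\<bar>sin s\<bar> - sin s\<close> is 0, and it never exceeds 2, which explains the
        factor 2 of the step.\<close>
      show "\<bar>sin s\<bar> \<le> sin s + 2 * odd_step pi s"
      proof (cases "s < pi")
        case True
        then have "sin s \<ge> 0" using s by (intro sin_ge_zero) auto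
        moreover have "odd_step pi s \<ge> 0" using s by (simp add: odd_step_def)
        ultimately show ?thesis by simp
      next
        case False
        then have "odd_step pi s = 1" using less_le_trans[OF pi_gt_zero, of s] by (simp add: odd_step_def)
        then show ?thesis using abs_sin_le_one[of s] by linarith
      qed
    qed
    finally show "\<bar>h (m + s) - h (m - s)\<bar> \<le> w s" by (simp add: w_def algebra_simps)
  qed (use assms \<delta> in auto)
  also have "\<dots> = c * gauss_avg t sin \<delta> + (2 * c) * gauss_avg t (odd_step pi) \<delta>"
    unfolding w_def using odd_step_props(1) odd_step_props(2)[of pi] bd(1) assms(1)
    by (subst gauss_avg_add[where B="c" and C="2 * c"])
      (auto simp: gauss_avg_cmult abs_mult intro!: mult_left_le)
  also have "\<dots> \<le> c * (exp (- t / 2) * sin \<delta>) + (2 * c) * (2 * \<delta> * ?M)"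
  proof -
    have "gauss_avg t (odd_step pi) \<delta> \<le> 2 * \<delta> * ?M"
      using \<delta> assms(1) by (intro gauss_avg_odd_step normal_density_antimono) auto
    then show ?thesis using bd(1) assms(1)
      by (intro add_mono mult_left_mono) (auto simp: gauss_avg_sin)
  qed
  also have "\<dots> \<le> c * (exp (- t / 2) * sin \<delta>) + (2 * c) * (2 * (pi / 2 * sin \<delta>) * ?M)"
    using le_half_pi_sin[OF \<delta>] bd(1) by (intro add_left_mono mult_left_mono mult_right_mono) auto
  finally show "\<bar>gauss_avg t h (m + \<delta>) - gauss_avg t h (m - \<delta>)\<bar>
    \<le> c * (exp (- t / 2) + 2 * pi * ?M) * chord (m + \<delta>) (m - \<delta>)"
    using sin0 by (simp add: chord_def algebra_simps)
next
  show "\<bar>gauss_avg t h b - gauss_avg t h a\<bar> \<le> c * (exp (- t / 2) + 2 * pi * normal_density 0 (sqrt t) (pi / 2)) * chord b a"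
    if "\<bar>gauss_avg t h a - gauss_avg t h b\<bar> \<le> c * (exp (- t / 2) + 2 * pi * normal_density 0 (sqrt t) (pi / 2)) * chord a b" for a b
    using that by (simp add: chord_props(4)[of b a] abs_minus_commute[of "gauss_avg t h b"])
next
  show "\<bar>gauss_avg t h (a + 2 * pi * of_int n) - gauss_avg t h b\<bar> \<le> c * (exp (- t / 2) + 2 * pi * normal_density 0 (sqrt t) (pi / 2)) * chord (a + 2 * pi * of_int n) b"
    if "\<bar>gauss_avg t h a - gauss_avg t h b\<bar> \<le> c * (exp (- t / 2) + 2 * pi * normal_density 0 (sqrt t) (pi / 2)) * chord a b" for a b and n :: int
    using that gauss_avg_periodic[of h t a n, OF chord_lipschitz_periodic[OF h(2)]] by (simp only: chord_eq_mod)
qed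

text \<open>The same comparison with the sign function as majorant. It uses the oscillation
  \<open>c\<close> of \<open>h\<close> and no continuity, and so turns bounded functions into
  Lipschitz ones. The factor \<open>pi\<close> comes from
  \<open>2 * \<delta> \<le> pi * sin \<delta>\<close>.\<close>

lemma gauss_avg_smooth:
  assumes "t > 0" and h: "h \<in> borel_measurable borel" "\<And>s. \<bar>h s\<bar> \<le> B" "\<And>a b. \<bar>h a - h b\<bar> \<le> c"
    and per: "\<And>s n. h (s + 2 * pi * of_int n) = h s"
  shows "\<bar>gauss_avg t h a - gauss_avg t h b\<bar> \<le> c * (pi * normal_density 0 (sqrt t) 0) * chord a b"
proof (rule circle_pair_wlog[of "\<lambda>a b. \<bar>gauss_avg t h a - gauss_avg t h b\<bar>
    \<le> c * (pi * normal_density 0 (sqrt t) 0) * chord a b" a b])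
  let ?M = "normal_density 0 (sqrt t) 0"
  fix m \<delta> :: real assume \<delta>: "0 \<le> \<delta>" "\<delta> \<le> pi / 2"
  have sin0: "sin \<delta> \<ge> 0" using \<delta> by (intro sin_ge_zero) auto
  have c: "c \<ge> 0" using h(3)[of 0 0] by simp
  have "\<bar>gauss_avg t h (m + \<delta>) - gauss_avg t h (m - \<delta>)\<bar> = \<bar>gauss_avg t (\<lambda>s. h (m + s) - h (m - s)) \<delta>\<bar>"
    using gauss_avg_antisym[OF assms(1,2) h(2)] by simp
  also have "\<dots> \<le> gauss_avg t (\<lambda>s. c * odd_step 0 s) \<delta>"
  proof (rule gauss_avg_odd_mono)
    show "(\<lambda>s. h (m + s) - h (m - s)) \<in> borel_measurable borel" using h(1) by measurable
    show "(\<lambda>s. c * odd_step 0 s) \<in> borel_measurable borel" using odd_step_props(1) by measurable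
    show "\<bar>c * odd_step 0 s\<bar> \<le> c" for s using c odd_step_props(2)[of 0 s] by (simp add: abs_mult mult_left_le)
    show "\<bar>h (m + s) - h (m - s)\<bar> \<le> c * odd_step 0 s" if "s \<ge> 0" for s
      using h(3) that by (cases "s = 0") (auto simp: odd_step_def)
  qed (use assms \<delta> in \<open>auto simp: odd_step_props(3)\<close>)
  also have "\<dots> = c * gauss_avg t (odd_step 0) \<delta>" by (rule gauss_avg_cmult)
  also have "\<dots> \<le> c * (2 * \<delta> * ?M)"
    using \<delta> assms(1) c by (intro mult_left_mono gauss_avg_odd_step normal_density_antimono) auto
  also have "\<dots> \<le> c * (2 * (pi / 2 * sin \<delta>) * ?M)"
    using le_half_pi_sin[OF \<delta>] c by (intro mult_left_mono mult_right_mono) auto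
  finally show "\<bar>gauss_avg t h (m + \<delta>) - gauss_avg t h (m - \<delta>)\<bar>
    \<le> c * (pi * ?M) * chord (m + \<delta>) (m - \<delta>)"
    using sin0 by (simp add: chord_def algebra_simps)
next
  show "\<bar>gauss_avg t h b - gauss_avg t h a\<bar> \<le> c * (pi * normal_density 0 (sqrt t) 0) * chord b a"
    if "\<bar>gauss_avg t h a - gauss_avg t h b\<bar> \<le> c * (pi * normal_density 0 (sqrt t) 0) * chord a b" for a b
    using that by (simp add: chord_props(4)[of b a] abs_minus_commute[of "gauss_avg t h b"])
next
  show "\<bar>gauss_avg t h (a + 2 * pi * of_int n) - gauss_avg t h b\<bar> \<le> c * (pi * normal_density 0 (sqrt t) 0) * chord (a + 2 * pi * of_int n) b"
    if "\<bar>gauss_avg t h a - gauss_avg t h b\<bar> \<le> c * (pi * normal_density 0 (sqrt t) 0) * chord a b" for a b and n :: int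
    using that gauss_avg_periodic[of h t a n, OF per] by (simp only: chord_eq_mod)
qed

section \<open>Composition of many small steps\<close>

lemma gauss_avg_measurable [measurable]:
  assumes [measurable]: "h \<in> borel_measurable borel"
  shows "gauss_avg t h \<in> borel_measurable borel"
  unfolding gauss_avg_def[abs_def] by measurable

text \<open>Variances of independent centred normal variables add up. The inner average is rewritten
  in terms of the total displacement \<open>c\<close>; exchanging the integrals then leaves the
  convolution of the two densities in front of \<open>h (x + c)\<close>.\<close>

lemma gauss_avg_semigroup:
  assumes t: "s > 0" "t > 0" and h [measurable]: "h \<in> borel_measurable borel" and B: "\<And>s. \<bar>h s\<bar> \<le> B"
  shows "gauss_avg s (gauss_avg t h) x = gauss_avg (s + t) h x"
proof -
  let ?G = "\<lambda>t. normal_density 0 (sqrt t)"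
  interpret lborel_pair: pair_sigma_finite "lborel :: real measure" "lborel :: real measure" ..
  have it: "integrable lborel (\<lambda>c. ?G t (c - a))" for a
    using integrable_gauss_mult[OF t(2), of "\<lambda>_. 1" 1 a 0] by simp
  have i1: "(\<integral>c. ?G t (c - a) \<partial>lborel) = 1" for a
    using gauss_avg_shift[of t "\<lambda>_. 1" a] t(2) by (simp add: gauss_avg_def)
  have "integrable (lborel \<Otimes>\<^sub>M lborel) (\<lambda>z. ?G s (fst z) * ?G t (snd z - fst z))"
  proof (rule lborel_pair.Fubini_integrable)
    show "integrable lborel (\<lambda>a. \<integral>c. norm (?G s (fst (a, c)) * ?G t (snd (a, c) - fst (a, c))) \<partial>lborel)"
      using t i1 by (simp add: abs_mult)
    show "AE a in lborel. integrable lborel (\<lambda>c. ?G s (fst (a, c)) * ?G t (snd (a, c) - fst (a, c)))"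
      using it by simp
  qed measurable
  then have "integrable (lborel \<Otimes>\<^sub>M lborel) (\<lambda>z. ?G s (fst z) * ?G t (snd z - fst z) * h (x + snd z))"
    by (rule integrable_mult_bounded[where B=B]) (use B in auto)
  then have fub: "(\<integral>c. (\<integral>a. ?G s a * ?G t (c - a) * h (x + c) \<partial>lborel) \<partial>lborel)
     = (\<integral>a. (\<integral>c. ?G s a * ?G t (c - a) * h (x + c) \<partial>lborel) \<partial>lborel)"
    by (intro lborel_pair.Fubini_integral) (simp add: case_prod_beta')
  have conv: "(\<integral>a. ?G s a * ?G t (c - a) \<partial>lborel) = ?G (s + t) c" for c
  proof -
    have "(\<integral>\<^sup>+a. ennreal (?G t (c - a) * ?G s a) \<partial>lborel) = ennreal (?G (s + t) c)"
      using fun_cong[OF conv_normal_density_zero_mean[of "sqrt t" "sqrt s"], of c] t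
      by (simp add: add.commute)
    then show ?thesis
      by (subst integral_eq_nn_integral) (auto simp: mult.commute)
  qed
  have "gauss_avg s (gauss_avg t h) x
      = (\<integral>a. (\<integral>c. ?G s a * ?G t (c - a) * h (x + c) \<partial>lborel) \<partial>lborel)"
  proof -
    have "gauss_avg t h (x + a) = (\<integral>c. ?G t (c - a) * h (x + c) \<partial>lborel)" for a
      using gauss_avg_shift[of t "\<lambda>s. h (x + s)" a] gauss_avg_translate[of t h x a] by simp
    then show ?thesis
      by (simp add: gauss_avg_def[of s] mult.assoc)
  qed
  also have "\<dots> = (\<integral>c. ?G (s + t) c * h (x + c) \<partial>lborel)"
    by (simp add: fub[symmetric] conv)
  finally show ?thesis by (simp add: gauss_avg_def)
qed

text \<open>Counting from \<open>Suc n\<close> keeps the variance positive: at variance 0 the normal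
  density is 0, by the convention for division by 0, and \<open>gauss_avg\<close> is not the
  identity.\<close>

lemma gauss_avg_contract_steps:
  assumes "t > 0" and h: "h \<in> borel_measurable borel" "\<And>a b. \<bar>h a - h b\<bar> \<le> c * chord a b"
  defines "\<kappa> \<equiv> exp (- t / 2) + 2 * pi * normal_density 0 (sqrt t) (pi / 2)"
  shows "\<bar>gauss_avg (real (Suc n) * t) h a - gauss_avg (real (Suc n) * t) h b\<bar>
    \<le> c * \<kappa> ^ Suc n * chord a b"
proof (induction n arbitrary: a b)
  case 0
  then show ?case
    using gauss_avg_contract_step[OF assms(1) h] by (simp add: \<kappa>_def)
next
  case (Suc n)
  have "gauss_avg (real (Suc (Suc n)) * t) h x = gauss_avg t (gauss_avg (real (Suc n) * t) h) x" for x
    using gauss_avg_semigroup[OF assms(1) _ h(1) chord_lipschitz_bounded(2)[OF h(2)], of "real (Suc n) * t" x] assms(1)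
    by (simp add: distrib_right add.assoc add.left_commute add.commute add_pos_nonneg)
  moreover have "gauss_avg (real (Suc n) * t) h \<in> borel_measurable borel"
    using h(1) by measurable
  ultimately show ?case
    using gauss_avg_contract_step[OF assms(1) _ Suc.IH, of a b]
    unfolding \<kappa>_def[symmetric] by (simp only: power_Suc mult_ac)
qed

text \<open>Write \<open>m\<close> for \<open>Suc n\<close>. The power of the exponential alone is
  exactly \<open>exp (- \<beta> / 2)\<close>. The other summand is of order
  \<open>sqrt m * exp (- pi\<^sup>2 * m / (8 * \<beta>))\<close>, so even \<open>m\<close> times it
  tends to 0.\<close>

lemma contraction_factor_limit:
  assumes "\<beta> > 0"
  shows "(\<lambda>n. (exp (- (\<beta> / real (Suc n)) / 2) + 2 * pi * normal_density 0 (sqrt (\<beta> / real (Suc n))) (pi / 2)) ^ Suc n)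
    \<longlonglongrightarrow> exp (- \<beta> / 2)"
proof -
  have "(\<lambda>n. (exp (- (\<beta> / real n) / 2) + 2 * pi * (1 / sqrt (2 * pi * (\<beta> / n))
      * exp (- ((pi / 2) ^ 2) / (2 * (\<beta> / n))))) powr n) \<longlonglongrightarrow> exp (- \<beta> / 2)"
    using assms by real_asymp
  from LIMSEQ_Suc[OF this] show ?thesis
  proof (rule Lim_transform_eventually, intro always_eventually allI)
    fix n
    have "0 < exp (- (\<beta> / real (Suc n)) / 2) + 2 * pi * normal_density 0 (sqrt (\<beta> / real (Suc n))) (pi / 2)"
      by (intro add_pos_nonneg) auto
    then show "(exp (- (\<beta> / real (Suc n)) / 2) + 2 * pi * (1 / sqrt (2 * pi * (\<beta> / real (Suc n)))
        * exp (- ((pi / 2) ^ 2) / (2 * (\<beta> / real (Suc n)))))) powr real (Suc n)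
      = (exp (- (\<beta> / real (Suc n)) / 2) + 2 * pi * normal_density 0 (sqrt (\<beta> / real (Suc n))) (pi / 2)) ^ Suc n"
      using assms by (subst powr_realpow[symmetric]) (simp_all add: normal_density_def)
  qed
qed

lemma gauss_avg_contract:
  assumes "\<beta> > 0" and h: "h \<in> borel_measurable borel" "\<And>a b. \<bar>h a - h b\<bar> \<le> c * chord a b"
  shows "\<bar>gauss_avg \<beta> h a - gauss_avg \<beta> h b\<bar> \<le> c * exp (- \<beta> / 2) * chord a b"
proof (rule LIMSEQ_le_const)
  show "(\<lambda>n. c * (exp (- (\<beta> / real (Suc n)) / 2) + 2 * pi * normal_density 0 (sqrt (\<beta> / real (Suc n))) (pi / 2)) ^ Suc n * chord a b)
    \<longlonglongrightarrow> c * exp (- \<beta> / 2) * chord a b"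
    by (intro tendsto_mult tendsto_const contraction_factor_limit assms(1))
  show "\<exists>N. \<forall>n\<ge>N. \<bar>gauss_avg \<beta> h a - gauss_avg \<beta> h b\<bar>
    \<le> c * (exp (- (\<beta> / real (Suc n)) / 2) + 2 * pi * normal_density 0 (sqrt (\<beta> / real (Suc n))) (pi / 2)) ^ Suc n * chord a b"
  proof (intro exI allI impI)
    fix n
    have "real (Suc n) * (\<beta> / real (Suc n)) = \<beta>" by simp
    then show "\<bar>gauss_avg \<beta> h a - gauss_avg \<beta> h b\<bar>
    \<le> c * (exp (- (\<beta> / real (Suc n)) / 2) + 2 * pi * normal_density 0 (sqrt (\<beta> / real (Suc n))) (pi / 2)) ^ Suc n * chord a b"
      using gauss_avg_contract_steps[OF _ h, of "\<beta> / real (Suc n)" n a b] assms(1) by simp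
  qed
qed

section \<open>The wrapped Gaussian kernel\<close>

definition wrap :: "real \<Rightarrow> real" where
  "wrap s = s - 2 * pi * of_int \<lfloor>s / (2 * pi)\<rfloor>"

lemma wrap_measurable [measurable]: "wrap \<in> borel_measurable borel"
  unfolding wrap_def[abs_def] by measurable

lemma wrap_periodic: "wrap (s + 2 * pi * of_int n) = wrap s"
proof -
  have "(s + 2 * pi * of_int n) / (2 * pi) = s / (2 * pi) + of_int n" by (simp add: field_simps)
  then show ?thesis by (simp add: wrap_def algebra_simps)
qed

lemma floor_turn_iff: "\<lfloor>s / (2 * pi)\<rfloor> = n \<longleftrightarrow> s - 2 * pi * of_int n \<in> {0..<2 * pi}"
  by (auto simp: floor_eq_iff field_simps)

lemma prob_space_sigmaS1: "prob_space sigmaS1"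
  unfolding sigmaS1_def by (rule prob_space_uniform_measure) auto

lemma sets_sigmaS1 [measurable_cong]: "sets sigmaS1 = sets borel"
  by (simp add: sigmaS1_def)

lemma space_sigmaS1: "space sigmaS1 = UNIV"
  by (simp add: sigmaS1_def)

lemma nn_integral_sigmaS1:
  assumes [measurable]: "f \<in> borel_measurable borel"
  shows "(\<integral>\<^sup>+y. f y \<partial>sigmaS1) = (\<integral>\<^sup>+y. f y * indicator {0..<2 * pi} y \<partial>lborel) / ennreal (2 * pi)"
  unfolding sigmaS1_def by (subst nn_integral_uniform_measure) auto

text \<open>No summability is needed: an infinite sum that does not converge and a Bochner integral that does not
  exist both have the value 0.\<close>
lemma phi_conv_integral:
  "phi \<beta> x y = 2 * pi * (\<integral>n. normal_density 0 (sqrt \<beta>) (y - x + 2 * pi * of_int n) \<partial>count_space (UNIV :: int set))"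
proof (cases "(\<lambda>n::int. normal_density 0 (sqrt \<beta>) (y - x + 2 * pi * of_int n)) summable_on UNIV")
  case True
  then show ?thesis
    unfolding phi_def
    by (metis infsetsum_infsum infsetsum_def abs_summable_equivalent summable_on_iff_abs_summable_on_real)
next
  case False
  then show ?thesis
    unfolding phi_def
    by (metis infsum_not_exists abs_summable_on_def not_integrable_integral_eq abs_summable_equivalent summable_on_iff_abs_summable_on_real)
qed

lemma phi_measurable [measurable (raw)]:
  assumes [measurable]: "f \<in> borel_measurable M" "g \<in> borel_measurable M"
  shows "(\<lambda>z. phi \<beta> (f z) (g z)) \<in> borel_measurable M"
proof -
  interpret sigma_finite_measure "count_space (UNIV :: int set)"
    by (rule sigma_finite_measure_count_space)
  have "(\<lambda>(z, n::int). normal_density 0 (sqrt \<beta>) (g z - f z + 2 * pi * of_int n))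
      \<in> borel_measurable (M \<Otimes>\<^sub>M count_space UNIV)"
    unfolding case_prod_beta' by measurable
  then show ?thesis
    unfolding phi_conv_integral by (intro borel_measurable_times borel_measurable_const borel_measurable_lebesgue_integral)
qed

lemma phi_nonneg [simp]: "phi \<beta> x y \<ge> 0"
  unfolding phi_conv_integral by simp

text \<open>The line is cut into full turns and each is moved back to \<open>{0..<2 * pi}\<close>.
  With values in \<open>ennreal\<close>, sums and integrals may be exchanged without convergence
  conditions.\<close>

lemma nn_integral_phi:
  assumes "\<beta> > 0" and [measurable]: "f \<in> borel_measurable borel"
  shows "(\<integral>\<^sup>+y. ennreal (phi \<beta> x y) * f y \<partial>sigmaS1)
    = (\<integral>\<^sup>+s. ennreal (normal_density 0 (sqrt \<beta>) (s - x)) * f (wrap s) \<partial>lborel)"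
proof -
  let ?G = "\<lambda>y. ennreal (normal_density 0 (sqrt \<beta>) y)"
  define S where "S y = (\<integral>\<^sup>+n. ?G (y - x + 2 * pi * of_int n) \<partial>count_space (UNIV :: int set))" for y
  have meas: "(\<lambda>(z, n::int). ?G (z - x + 2 * pi * of_int n)) \<in> borel_measurable (borel \<Otimes>\<^sub>M count_space UNIV)"
    unfolding case_prod_beta' by measurable
  interpret sigma_finite_measure "count_space (UNIV :: int set)"
    by (rule sigma_finite_measure_count_space)
  have S[measurable]: "S \<in> borel_measurable borel"
    unfolding S_def[abs_def] using meas by (rule borel_measurable_nn_integral)
  have unfold: "(\<integral>\<^sup>+s. ?G (s - x) * f (wrap s) \<partial>lborel) = (\<integral>\<^sup>+y. S y * f y * indicator {0..<2 * pi} y \<partial>lborel)"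
    if [measurable]: "f \<in> borel_measurable borel" for f :: "real \<Rightarrow> ennreal"
  proof -
    have "(\<integral>\<^sup>+s. ?G (s - x) * f (wrap s) \<partial>lborel)
      = (\<integral>\<^sup>+s. (\<integral>\<^sup>+n. ?G (s - x) * f (s - 2 * pi * of_int n) * indicator {0..<2 * pi} (s - 2 * pi * of_int n) \<partial>count_space (UNIV :: int set)) \<partial>lborel)"
    proof (rule nn_integral_cong)
      fix s :: real
      \<comment> \<open>Exactly one number of turns brings \<open>s\<close> into the fundamental
        interval, so the sum reduces to a single term.\<close>
      have "(\<integral>\<^sup>+n. ?G (s - x) * f (s - 2 * pi * of_int n) * indicator {0..<2 * pi} (s - 2 * pi * of_int n) \<partial>count_space (UNIV :: int set))
        = (\<Sum>n\<in>{\<lfloor>s / (2 * pi)\<rfloor>}. ?G (s - x) * f (s - 2 * pi * of_int n) * indicator {0..<2 * pi} (s - 2 * pi * of_int n))"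
        by (rule nn_integral_count_space') (auto simp: indicator_def floor_turn_iff[symmetric] simp del: atLeastLessThan_iff split: if_splits)
      also have "\<dots> = ?G (s - x) * f (wrap s)"
        using floor_turn_iff[of s "\<lfloor>s / (2 * pi)\<rfloor>"] by (simp add: wrap_def)
      finally show "?G (s - x) * f (wrap s) = (\<integral>\<^sup>+n. ?G (s - x) * f (s - 2 * pi * of_int n) * indicator {0..<2 * pi} (s - 2 * pi * of_int n) \<partial>count_space (UNIV :: int set))"
        by simp
    qed
    also have "\<dots> = (\<integral>\<^sup>+n. (\<integral>\<^sup>+s. ?G (s - x) * f (s - 2 * pi * of_int n) * indicator {0..<2 * pi} (s - 2 * pi * of_int n) \<partial>lborel) \<partial>count_space (UNIV :: int set))"
      by (rule nn_integral_count_space_nn_integral) (auto simp: countableI_type)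
    also have "\<dots> = (\<integral>\<^sup>+n. (\<integral>\<^sup>+y. ?G (y - x + 2 * pi * of_int n) * f y * indicator {0..<2 * pi} y \<partial>lborel) \<partial>count_space (UNIV :: int set))"
    proof (rule nn_integral_cong)
      fix n :: int
      show "(\<integral>\<^sup>+s. ?G (s - x) * f (s - 2 * pi * of_int n) * indicator {0..<2 * pi} (s - 2 * pi * of_int n) \<partial>lborel)
        = (\<integral>\<^sup>+y. ?G (y - x + 2 * pi * of_int n) * f y * indicator {0..<2 * pi} y \<partial>lborel)"
        by (subst nn_integral_real_affine[where c=1 and t="2 * pi * of_int n"]) (auto simp: algebra_simps)
    qed
    also have "\<dots> = (\<integral>\<^sup>+y. (\<integral>\<^sup>+n. ?G (y - x + 2 * pi * of_int n) * f y * indicator {0..<2 * pi} y \<partial>count_space (UNIV :: int set)) \<partial>lborel)"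
      by (rule nn_integral_count_space_nn_integral[symmetric]) (auto simp: countableI_type)
    also have "\<dots> = (\<integral>\<^sup>+y. S y * f y * indicator {0..<2 * pi} y \<partial>lborel)"
      by (simp add: S_def mult.assoc nn_integral_multc)
    finally show ?thesis .
  qed
  have "(\<integral>\<^sup>+s. ?G (s - x) \<partial>lborel) = 1"
  proof -
    have "(\<integral>\<^sup>+s. ?G (s - x) \<partial>lborel) = (\<integral>\<^sup>+s. ?G s \<partial>lborel)"
      by (subst nn_integral_real_affine[where c=1 and t=x]) auto
    also have "\<dots> = 1"
      using assms(1) by (subst nn_integral_eq_integral) auto
    finally show ?thesis .
  qed
  then have "(\<integral>\<^sup>+y. S y * indicator {0..<2 * pi} y \<partial>lborel) = 1"
    using unfold[of "\<lambda>_. 1"] by simp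
  \<comment> \<open>Total mass 1 makes the series finite almost everywhere. At a point where it were
    infinite, \<open>phi\<close> would take the default value 0 and the identity
    \<open>phi_S\<close> would fail.\<close>
  then have fin: "AE y in lborel. S y * indicator {0..<2 * pi} y \<noteq> \<infinity>"
    by (intro nn_integral_PInf_AE) auto
  have phi_S: "ennreal (phi \<beta> x y) = ennreal (2 * pi) * S y" if "S y \<noteq> \<infinity>" for y
  proof -
    have "(\<integral>n. normal_density 0 (sqrt \<beta>) (y - x + 2 * pi * of_int n) \<partial>count_space (UNIV :: int set)) = enn2real (S y)"
      unfolding S_def by (rule integral_eq_nn_integral) auto
    then show ?thesis
      using that by (simp add: phi_conv_integral ennreal_mult less_top)
  qed
  have "(\<integral>\<^sup>+y. ennreal (phi \<beta> x y) * f y \<partial>sigmaS1)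
    = (\<integral>\<^sup>+y. ennreal (phi \<beta> x y) * f y * indicator {0..<2 * pi} y \<partial>lborel) / ennreal (2 * pi)"
    by (rule nn_integral_sigmaS1) measurable
  also have "(\<integral>\<^sup>+y. ennreal (phi \<beta> x y) * f y * indicator {0..<2 * pi} y \<partial>lborel)
    = (\<integral>\<^sup>+y. ennreal (2 * pi) * (S y * f y * indicator {0..<2 * pi} y) \<partial>lborel)"
    by (rule nn_integral_cong_AE, rule AE_mp[OF fin]) (auto simp: indicator_def phi_S mult.assoc)
  also have "\<dots> = ennreal (2 * pi) * (\<integral>\<^sup>+y. S y * f y * indicator {0..<2 * pi} y \<partial>lborel)"
    by (rule nn_integral_cmult) measurable
  also have "\<dots> / ennreal (2 * pi) = (\<integral>\<^sup>+y. S y * f y * indicator {0..<2 * pi} y \<partial>lborel)"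
    by (subst mult.commute, rule ennreal_mult_divide_eq) auto
  finally show ?thesis by (simp add: unfold)
qed

lemma density_phi_eq_distr:
  assumes "\<beta> > 0"
  shows "density sigmaS1 (\<lambda>y. ennreal (phi \<beta> x y))
    = distr (density lborel (\<lambda>s. ennreal (normal_density 0 (sqrt \<beta>) (s - x)))) borel wrap"
proof (rule measure_eqI)
  fix A assume "A \<in> sets (density sigmaS1 (\<lambda>y. ennreal (phi \<beta> x y)))"
  then have [measurable]: "A \<in> sets borel" by (simp add: sets_sigmaS1)
  show "emeasure (density sigmaS1 (\<lambda>y. ennreal (phi \<beta> x y))) A
    = emeasure (distr (density lborel (\<lambda>s. ennreal (normal_density 0 (sqrt \<beta>) (s - x)))) borel wrap) A"
    using nn_integral_phi[OF assms, of "indicator A" x]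
    by (subst emeasure_density)
      (simp_all add: emeasure_distr emeasure_density sets_sigmaS1 indicator_def vimage_def)
qed (simp add: sets_sigmaS1)

lemma integral_phi:
  assumes "\<beta> > 0" and [measurable]: "h \<in> borel_measurable borel"
  shows "(\<integral>y. phi \<beta> x y * h y \<partial>sigmaS1) = gauss_avg \<beta> (\<lambda>s. h (wrap s)) x"
proof -
  have "(\<integral>y. phi \<beta> x y * h y \<partial>sigmaS1) = (\<integral>y. h y \<partial>density sigmaS1 (\<lambda>y. ennreal (phi \<beta> x y)))"
    by (subst integral_density) auto
  also have "\<dots> = (\<integral>s. h (wrap s) \<partial>density lborel (\<lambda>s. ennreal (normal_density 0 (sqrt \<beta>) (s - x))))"
    unfolding density_phi_eq_distr[OF assms(1)] by (rule integral_distr) auto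
  also have "\<dots> = gauss_avg \<beta> (\<lambda>s. h (wrap s)) x"
    by (subst integral_density) (auto simp: gauss_avg_shift)
  finally show ?thesis .
qed

lemma integrable_phi: 
  assumes "\<beta> > 0"
  shows "integrable sigmaS1 (phi \<beta> x)" and "(\<integral>y. phi \<beta> x y \<partial>sigmaS1) = 1"
proof -
  show 1: "(\<integral>y. phi \<beta> x y \<partial>sigmaS1) = 1"
    using integral_phi[OF assms, of "\<lambda>_. 1" x] assms by (simp add: gauss_avg_def)
  \<comment> \<open>If it were not integrable, its integral would be 0, not 1.\<close>
  show "integrable sigmaS1 (phi \<beta> x)"
    using 1 not_integrable_integral_eq by fastforce
qed

lemma lambda_phi_eq:
  assumes "\<beta> > 0"
  shows "lambda_phi \<beta> = exp (- \<beta> / 2)"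
proof -
  have "cos (wrap s) = cos s" for s
  proof -
    have "cos (wrap s + 2 * pi * of_int \<lfloor>s / (2 * pi)\<rfloor>) = cos (wrap s)"
      using sin_int_2pin cos_int_2pin by (simp add: cos_add)
    then show ?thesis by (simp add: wrap_def)
  qed
  then show ?thesis
    using integral_phi[OF assms, of cos 0] gauss_avg_cos_0[OF assms]
    by (simp add: lambda_phi_def mult.commute)
qed

lemma phi_contract:
  assumes "\<beta> > 0" and h: "h \<in> borel_measurable borel" "\<And>a b. \<bar>h a - h b\<bar> \<le> c * chord a b"
  shows "\<bar>(\<integral>z. phi \<beta> x z * h z \<partial>sigmaS1) - (\<integral>z. phi \<beta> y z * h z \<partial>sigmaS1)\<bar>
    \<le> c * lambda_phi \<beta> * chord x y"
proof -
  have "h (wrap s) = h s" for s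
    using chord_lipschitz_periodic[OF h(2), of "wrap s" "\<lfloor>s / (2 * pi)\<rfloor>"] by (simp add: wrap_def)
  then show ?thesis
    using gauss_avg_contract[OF assms, of x y] assms(1)
    by (simp add: integral_phi[OF assms(1) h(1)] lambda_phi_eq)
qed

text \<open>\<open>h\<close> is merely bounded and may fail to be periodic; the estimate on the line
  is applied to \<open>h (wrap s)\<close>, which is periodic and satisfies the same bounds.\<close>

lemma phi_smooth:
  assumes "\<beta> > 0" and h: "h \<in> borel_measurable borel" "\<And>s. \<bar>h s\<bar> \<le> B" "\<And>a b. \<bar>h a - h b\<bar> \<le> c"
  shows "\<bar>(\<integral>z. phi \<beta> x z * h z \<partial>sigmaS1) - (\<integral>z. phi \<beta> y z * h z \<partial>sigmaS1)\<bar>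
    \<le> c * (pi * normal_density 0 (sqrt \<beta>) 0) * chord x y"
  unfolding integral_phi[OF assms(1) h(1)]
  using h by (intro gauss_avg_smooth[where B=B]) (auto simp: assms(1) wrap_periodic)

section \<open>Products of kernels\<close>

lemma weighted_avg_bound:
  fixes f h :: "'a \<Rightarrow> real"
  assumes f: "integrable M f" "\<And>s. f s \<ge> 0" "integral\<^sup>L M f = 1"
    and h: "h \<in> borel_measurable M" "\<And>s. s \<in> space M \<Longrightarrow> \<bar>h s\<bar> \<le> B"
  shows "\<bar>\<integral>s. f s * h s \<partial>M\<bar> \<le> B"
proof -
  have i: "integrable M (\<lambda>s. f s * h s)"
    by (rule integrable_mult_bounded[OF f(1) h])
  have "\<bar>\<integral>s. f s * h s \<partial>M\<bar> \<le> (\<integral>s. \<bar>f s * h s\<bar> \<partial>M)" by (rule integral_abs_bound)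
  also have "\<dots> \<le> (\<integral>s. f s * B \<partial>M)"
    using i f h by (intro integral_mono integrable_abs) (auto simp: abs_mult intro!: mult_left_mono)
  also have "\<dots> = B" using f(3) by simp
  finally show ?thesis .
qed

lemma weighted_avg_diff_bound:
  fixes f h k :: "'a \<Rightarrow> real"
  assumes f: "integrable M f" "\<And>s. f s \<ge> 0" "integral\<^sup>L M f = 1"
    and h: "h \<in> borel_measurable M" "\<And>s. s \<in> space M \<Longrightarrow> \<bar>h s\<bar> \<le> B"
    and k: "k \<in> borel_measurable M" "\<And>s. s \<in> space M \<Longrightarrow> \<bar>k s\<bar> \<le> B"
    and hk: "\<And>s. s \<in> space M \<Longrightarrow> \<bar>h s - k s\<bar> \<le> C"
  shows "\<bar>(\<integral>s. f s * h s \<partial>M) - (\<integral>s. f s * k s \<partial>M)\<bar> \<le> C"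
proof -
  have "(\<integral>s. f s * h s \<partial>M) - (\<integral>s. f s * k s \<partial>M) = (\<integral>s. f s * (h s - k s) \<partial>M)"
    using integrable_mult_bounded[OF f(1) h] integrable_mult_bounded[OF f(1) k]
    by (simp add: right_diff_distrib)
  then show ?thesis
    using weighted_avg_bound[OF f, of "\<lambda>s. h s - k s" C] h(1) k(1) hk by simp
qed

lemma product_prob_space_sigmaS1: "product_prob_space (\<lambda>_. sigmaS1)"
  using prob_space_sigmaS1
  by (intro product_prob_space.intro product_prob_space_axioms.intro product_sigma_finite.intro)
    (auto intro: prob_space_imp_sigma_finite)

abbreviation (input) torus :: "'i set \<Rightarrow> ('i \<Rightarrow> real) measure" where
  "torus J \<equiv> PiM J (\<lambda>_. sigmaS1)"

lemma space_torus: "space (torus J) = extensional J"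
  by (auto simp: space_PiM space_sigmaS1 PiE_def)

definition kernel_avg :: "real \<Rightarrow> 'i set \<Rightarrow> ('i \<Rightarrow> real) \<Rightarrow> (('i \<Rightarrow> real) \<Rightarrow> real) \<Rightarrow> real" where
  "kernel_avg \<beta> J x F = (\<integral>z. (\<Prod>u\<in>J. phi \<beta> (x u) (z u)) * F z \<partial>torus J)"

lemma kernel_density:
  assumes "\<beta> > 0" "finite J"
  shows "integrable (torus J) (\<lambda>z. \<Prod>u\<in>J. phi \<beta> (x u) (z u))"
    and "(\<integral>z. (\<Prod>u\<in>J. phi \<beta> (x u) (z u)) \<partial>torus J) = 1"
    and "(\<Prod>u\<in>J. phi \<beta> (x u) (z u)) \<ge> 0"
proof -
  interpret product_prob_space "\<lambda>_. sigmaS1" by (rule product_prob_space_sigmaS1)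
  show "integrable (torus J) (\<lambda>z. \<Prod>u\<in>J. phi \<beta> (x u) (z u))"
    using assms by (intro product_integrable_prod integrable_phi)
  show "(\<integral>z. (\<Prod>u\<in>J. phi \<beta> (x u) (z u)) \<partial>torus J) = 1"
    using assms by (subst product_integral_prod) (auto simp: integrable_phi)
qed (simp add: prod_nonneg)

lemma kernel_avg_insert:
  assumes "\<beta> > 0" "finite J" "u \<notin> J"
    and F: "F \<in> borel_measurable (torus (insert u J))" "\<And>z. z \<in> extensional (insert u J) \<Longrightarrow> \<bar>F z\<bar> \<le> B"
  shows "kernel_avg \<beta> (insert u J) x F
    = kernel_avg \<beta> J x (\<lambda>z. \<integral>s. phi \<beta> (x u) s * F (z(u := s)) \<partial>sigmaS1)"
proof -
  interpret product_prob_space "\<lambda>_. sigmaS1" by (rule product_prob_space_sigmaS1)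
  have "integrable (torus (insert u J)) (\<lambda>z. (\<Prod>u\<in>insert u J. phi \<beta> (x u) (z u)) * F z)"
    using assms by (intro integrable_mult_bounded[where B=B] kernel_density) (auto simp: space_torus)
  then have "kernel_avg \<beta> (insert u J) x F
    = (\<integral>z. (\<integral>s. (\<Prod>v\<in>insert u J. phi \<beta> (x v) ((z(u := s)) v)) * F (z(u := s)) \<partial>sigmaS1) \<partial>torus J)"
    unfolding kernel_avg_def using assms(2,3) by (intro product_integral_insert)
  moreover have "(\<Prod>v\<in>insert u J. phi \<beta> (x v) ((z(u := s)) v)) = (\<Prod>v\<in>J. phi \<beta> (x v) (z v)) * phi \<beta> (x u) s" for z s
  proof -
    have "(\<Prod>v\<in>J. phi \<beta> (x v) ((z(u := s)) v)) = (\<Prod>v\<in>J. phi \<beta> (x v) (z v))"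
      using assms(3) by (intro prod.cong) auto
    then show ?thesis using assms(2,3) by simp
  qed
  ultimately show ?thesis by (simp add: kernel_avg_def mult.assoc)
qed

text \<open>The function \<open>\<rho>\<close> will be the chord (contraction) or the discrete metric (smoothing).\<close>
lemma kernel_avg_lipschitz:
  fixes \<rho> :: "real \<Rightarrow> real \<Rightarrow> real"
  assumes \<beta>: "\<beta> > 0" and "finite J" and \<rho>: "\<And>a. \<rho> a a = 0"
    and one: "\<And>h x y. h \<in> borel_measurable borel \<Longrightarrow> (\<And>s. \<bar>h s\<bar> \<le> B) \<Longrightarrow> (\<And>a b. \<bar>h a - h b\<bar> \<le> c * \<rho> a b)
      \<Longrightarrow> \<bar>(\<integral>z. phi \<beta> x z * h z \<partial>sigmaS1) - (\<integral>z. phi \<beta> y z * h z \<partial>sigmaS1)\<bar> \<le> K * chord x y"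
    and "F \<in> borel_measurable (torus J)" "\<And>z. z \<in> extensional J \<Longrightarrow> \<bar>F z\<bar> \<le> B"
    and "\<And>z z'. z \<in> extensional J \<Longrightarrow> z' \<in> extensional J \<Longrightarrow> \<bar>F z - F z'\<bar> \<le> c * (\<Sum>u\<in>J. \<rho> (z u) (z' u))"
  shows "\<bar>kernel_avg \<beta> J x F - kernel_avg \<beta> J y F\<bar> \<le> K * (\<Sum>u\<in>J. chord (x u) (y u))"
  using assms(2,5-)
proof (induction J arbitrary: F rule: finite_induct)
  case empty
  then show ?case by (simp add: kernel_avg_def)
next
  case (insert u J)
  note F = insert.prems
  \<comment> \<open>The coordinate \<open>u\<close> is integrated out, with a transition from
    \<open>a\<close>. As a function of the other coordinates the result keeps the bound and the
    Lipschitz constant of \<open>F\<close>; as a function of \<open>a\<close> it falls under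
    \<open>one\<close>.\<close>
  define A where "A a z = (\<integral>s. phi \<beta> a s * F (z(u := s)) \<partial>sigmaS1)" for a z
  note dens = kernel_density[OF \<beta> insert.hyps(1)]
  note dens1 = integrable_phi(1)[OF \<beta>] phi_nonneg integrable_phi(2)[OF \<beta>]
  have upd: "z(u := s) \<in> extensional (insert u J)" if "z \<in> extensional J" for z and s :: real
    using that by (auto simp: extensional_def)
  have meas2: "(\<lambda>(z, s). F (z(u := s))) \<in> borel_measurable (torus J \<Otimes>\<^sub>M sigmaS1)"
    using measurable_compose[OF measurable_add_dim F(1)] by (simp add: case_prod_beta' fun_upd_def)
  have sec: "(\<lambda>s. F (z(u := s))) \<in> borel_measurable sigmaS1" if "z \<in> extensional J" for z
    using measurable_Pair2[OF meas2, of z] that by (simp add: space_torus)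
  have Ameas: "A a \<in> borel_measurable (torus J)" for a
  proof -
    interpret prob_space sigmaS1 by (rule prob_space_sigmaS1)
    show ?thesis unfolding A_def[abs_def]
      by (rule borel_measurable_lebesgue_integral) (use meas2 in \<open>simp add: case_prod_beta'\<close>)
  qed
  have Abd: "\<bar>A a z\<bar> \<le> B" if "z \<in> extensional J" for a z
    unfolding A_def using that by (intro weighted_avg_bound dens1 sec F(2) upd) auto
  have Alip: "\<bar>A a z - A a z'\<bar> \<le> c * (\<Sum>u\<in>J. \<rho> (z u) (z' u))"
    if "z \<in> extensional J" "z' \<in> extensional J" for a z z'
    unfolding A_def
  proof (rule weighted_avg_diff_bound[where B=B])
    fix s
    have "(\<Sum>v\<in>insert u J. \<rho> ((z(u := s)) v) ((z'(u := s)) v)) = (\<Sum>v\<in>J. \<rho> (z v) (z' v))"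
    proof -
      have "(\<Sum>v\<in>J. \<rho> ((z(u := s)) v) ((z'(u := s)) v)) = (\<Sum>v\<in>J. \<rho> (z v) (z' v))"
        using insert.hyps(2) by (intro sum.cong) auto
      then show ?thesis using insert.hyps \<rho> by simp
    qed
    then show "\<bar>F (z(u := s)) - F (z'(u := s))\<bar> \<le> c * (\<Sum>u\<in>J. \<rho> (z u) (z' u))"
      using F(3)[OF upd upd, OF that, of s s] by (simp only:)
  qed (use that dens1 sec F(2) upd in auto)
  have Adiff: "\<bar>A a z - A b z\<bar> \<le> K * chord a b" if "z \<in> extensional J" for a b z
    unfolding A_def
  proof (rule one)
    show "(\<lambda>s. F (z(u := s))) \<in> borel_measurable borel"
      using sec[OF that] by (simp cong: measurable_cong_sets add: sets_sigmaS1)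
    show "\<bar>F (z(u := s))\<bar> \<le> B" for s using that by (intro F(2) upd)
    show "\<bar>F (z(u := s)) - F (z(u := s'))\<bar> \<le> c * \<rho> s s'" for s s'
    proof -
      have "(\<Sum>v\<in>J. \<rho> ((z(u := s)) v) ((z(u := s')) v)) = 0"
        using insert.hyps(2) \<rho> by (intro sum.neutral) auto
      then have "(\<Sum>v\<in>insert u J. \<rho> ((z(u := s)) v) ((z(u := s')) v)) = \<rho> s s'"
        using insert.hyps by simp
      then show ?thesis using F(3)[OF upd upd, OF that that, of s s'] by (simp only:)
    qed
  qed
  have eq: "kernel_avg \<beta> (insert u J) x F = kernel_avg \<beta> J x (A (x u))" for x
    unfolding A_def using \<beta> insert.hyps F by (intro kernel_avg_insert)
  \<comment> \<open>Hybrid argument: the starting points in \<open>J\<close> are changed while the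
    one at \<open>u\<close> stays \<open>x u\<close>; then the one at \<open>u\<close> is
    changed.\<close>
  have "\<bar>kernel_avg \<beta> J x (A (x u)) - kernel_avg \<beta> J y (A (x u))\<bar> \<le> K * (\<Sum>u\<in>J. chord (x u) (y u))"
    by (intro insert.IH Ameas Abd Alip)
  moreover have "\<bar>kernel_avg \<beta> J y (A (x u)) - kernel_avg \<beta> J y (A (y u))\<bar> \<le> K * chord (x u) (y u)"
    unfolding kernel_avg_def
    by (rule weighted_avg_diff_bound[where B=B]) (use dens Ameas Abd Adiff in \<open>auto simp: space_torus\<close>)
  ultimately have "\<bar>kernel_avg \<beta> (insert u J) x F - kernel_avg \<beta> (insert u J) y F\<bar>
    \<le> K * (\<Sum>u\<in>J. chord (x u) (y u)) + K * chord (x u) (y u)"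
    unfolding eq by linarith
  then show ?case using insert.hyps by (simp add: algebra_simps)
qed

lemma kernel_avg_contract:
  assumes "\<beta> > 0" "finite J" "F \<in> borel_measurable (torus J)" "\<And>z. z \<in> extensional J \<Longrightarrow> \<bar>F z\<bar> \<le> B"
    and "\<And>z z'. z \<in> extensional J \<Longrightarrow> z' \<in> extensional J \<Longrightarrow> \<bar>F z - F z'\<bar> \<le> c * (\<Sum>u\<in>J. chord (z u) (z' u))"
  shows "\<bar>kernel_avg \<beta> J x F - kernel_avg \<beta> J y F\<bar> \<le> c * lambda_phi \<beta> * (\<Sum>u\<in>J. chord (x u) (y u))"
  by (rule kernel_avg_lipschitz[where \<rho>=chord and B=B and c=c])
    (use assms phi_contract[OF assms(1)] in \<open>auto simp: chord_props\<close>)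

text \<open>For the discrete metric the sum is the Hamming distance, which is at least 1 between
  different points, so every \<open>F\<close> bounded by \<open>B\<close> is Lipschitz with constant
  \<open>2 * B\<close>.\<close>

lemma kernel_avg_smooth:
  assumes "\<beta> > 0" "finite J" "F \<in> borel_measurable (torus J)" "\<And>z. z \<in> extensional J \<Longrightarrow> \<bar>F z\<bar> \<le> B"
  shows "\<bar>kernel_avg \<beta> J x F - kernel_avg \<beta> J y F\<bar>
    \<le> 2 * B * (pi * normal_density 0 (sqrt \<beta>) 0) * (\<Sum>u\<in>J. chord (x u) (y u))"
proof (rule kernel_avg_lipschitz[where \<rho>="\<lambda>a b. of_bool (a \<noteq> b)" and B=B and c="2 * B"])
  fix h :: "real \<Rightarrow> real" and x y
  assume h: "h \<in> borel_measurable borel" "\<And>s. \<bar>h s\<bar> \<le> B"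
  show "\<bar>(\<integral>z. phi \<beta> x z * h z \<partial>sigmaS1) - (\<integral>z. phi \<beta> y z * h z \<partial>sigmaS1)\<bar>
      \<le> 2 * B * (pi * normal_density 0 (sqrt \<beta>) 0) * chord x y"
  proof (rule phi_smooth[OF assms(1) h])
    show "\<bar>h a - h b\<bar> \<le> 2 * B" for a b using h(2)[of a] h(2)[of b] by linarith
  qed
next
  fix z z' :: "'a \<Rightarrow> real" assume z: "z \<in> extensional J" "z' \<in> extensional J"
  show "\<bar>F z - F z'\<bar> \<le> 2 * B * (\<Sum>u\<in>J. of_bool (z u \<noteq> z' u))"
  proof (cases "z = z'")
    case False
    then obtain u where "u \<in> J" "z u \<noteq> z' u" using z extensionalityI[of z J z'] by blast
    then have "1 \<le> (\<Sum>u\<in>J. of_bool (z u \<noteq> z' u) :: real)"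
      using member_le_sum[of u J "\<lambda>u. of_bool (z u \<noteq> z' u) :: real"] assms(2) by simp
    moreover have "B \<ge> 0" using assms(4)[OF z(1)] by simp
    ultimately have "2 * B * 1 \<le> 2 * B * (\<Sum>u\<in>J. of_bool (z u \<noteq> z' u))"
      by (intro mult_left_mono) auto
    then show ?thesis using assms(4)[OF z(1)] assms(4)[OF z(2)] by linarith
  qed simp
qed (use assms in auto)

section \<open>Influence of the root on the leaves\<close>

lemma finite_nodes_upto: "finite (nodes_upto q k)"
  unfolding nodes_upto_def using finite_lists_length_le[of "{..<q}" k] by (simp add: conj_commute)

lemma finite_level: "finite (level q k)"
  unfolding level_def using finite_lists_length_eq[of "{..<q}" k] by (simp add: conj_commute)

lemma level_subset: "level q k \<subseteq> nodes_upto q k"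
  by (auto simp: level_def nodes_upto_def)

lemma nodes_upto_Suc: "nodes_upto q (Suc k) - {[]} = (nodes_upto q k - {[]}) \<union> level q (Suc k)"
  by (auto simp: level_def nodes_upto_def)

lemma nodes_level_disjoint: "(nodes_upto q k - {[]}) \<inter> level q (Suc k) = {}"
  by (auto simp: level_def nodes_upto_def)

lemma root_in_nodes: "[] \<in> nodes_upto q k"
  by (simp add: nodes_upto_def)

lemma butlast_in_nodes: "v \<in> nodes_upto q k \<Longrightarrow> butlast v \<in> nodes_upto q k"
  by (auto simp: nodes_upto_def dest: in_set_butlastD)

lemma butlast_in_level: "v \<in> level q (Suc k) \<Longrightarrow> butlast v \<in> level q k"
  by (auto simp: level_def dest: in_set_butlastD)

text \<open>Each node of level \<open>k\<close> is the parent of \<open>q\<close> nodes: the origin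
  of the branching factor in the contraction rate.\<close>

lemma sum_level_Suc:
  "(\<Sum>u\<in>level q (Suc k). f (butlast u)) = real q * (\<Sum>v\<in>level q k. f v)"
proof -
  have "bij_betw (\<lambda>(v, i). v @ [i]) (level q k \<times> {..<q}) (level q (Suc k))"
    by (rule bij_betw_byWitness[where f'="\<lambda>u. (butlast u, last u)"])
      (auto simp: level_def length_Suc_conv_rev dest: in_set_butlastD)
  then have "(\<Sum>u\<in>level q (Suc k). f (butlast u)) = (\<Sum>p\<in>level q k \<times> {..<q}. f (butlast (case p of (v, i) \<Rightarrow> v @ [i])))"
    by (rule sum.reindex_bij_betw[symmetric])
  also have "\<dots> = (\<Sum>v\<in>level q k. \<Sum>i<q. f v)"
    by (subst sum.cartesian_product) (simp add: case_prod_beta')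
  finally show ?thesis by (simp add: sum_distrib_left)
qed

section \<open>Averages over the tree with a fixed root label\<close>

definition tree_weight :: "nat \<Rightarrow> real \<Rightarrow> nat \<Rightarrow> (nat list \<Rightarrow> real) \<Rightarrow> real" where
  "tree_weight q \<beta> k g = (\<Prod>v\<in>nodes_upto q k - {[]}. phi \<beta> (g (butlast v)) (g v))"

text \<open>Conditional expectation of \<open>F\<close> of the labels at depth \<open>k\<close>
  given the root label \<open>x\<close>, as an explicit integral and thus for every
  \<open>x\<close>, not just almost every one. The update at the root stands inside the restriction
  because for \<open>k = 0\<close> the level is the root itself.\<close>

definition root_avg :: "nat \<Rightarrow> real \<Rightarrow> nat \<Rightarrow> ((nat list \<Rightarrow> real) \<Rightarrow> real) \<Rightarrow> real \<Rightarrow> real" where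
  "root_avg q \<beta> k F x = (\<integral>g. tree_weight q \<beta> k (g([] := x)) * F (restrict (g([] := x)) (level q k))
     \<partial>torus (nodes_upto q k - {[]}))"

lemma tree_weight_nonneg: "tree_weight q \<beta> k g \<ge> 0"
  by (simp add: tree_weight_def prod_nonneg)

lemma tree_weight_measurable: "tree_weight q \<beta> k \<in> borel_measurable (torus (nodes_upto q k))"
  unfolding tree_weight_def[abs_def]
proof (intro borel_measurable_prod phi_measurable)
  fix v assume v: "v \<in> nodes_upto q k - {[]}"
  then have [measurable]: "v \<in> nodes_upto q k" "butlast v \<in> nodes_upto q k"
    by (auto intro: butlast_in_nodes)
  show "(\<lambda>g. g (butlast v)) \<in> borel_measurable (torus (nodes_upto q k))"
    "(\<lambda>g. g v) \<in> borel_measurable (torus (nodes_upto q k))"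
    by measurable
qed

lemma set_root_measurable:
  "(\<lambda>p. (snd p)([] := fst p)) \<in> sigmaS1 \<Otimes>\<^sub>M torus (nodes_upto q k - {[]}) \<rightarrow>\<^sub>M torus (nodes_upto q k)"
proof (rule measurable_fun_upd[where J="nodes_upto q k - {[]}"])
  show "nodes_upto q k = (nodes_upto q k - {[]}) \<union> {[]}" using root_in_nodes by auto
qed measurable

lemma set_root_measurable_at:
  "(\<lambda>g. g([] := x)) \<in> torus (nodes_upto q k - {[]}) \<rightarrow>\<^sub>M torus (nodes_upto q k)"
  using measurable_compose[OF measurable_Pair1' set_root_measurable, of x]
  by (simp add: space_sigmaS1)

lemma tree_weight_measurable_at:
  "(\<lambda>g. tree_weight q \<beta> k (g([] := x))) \<in> borel_measurable (torus (nodes_upto q k - {[]}))"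
  by (rule measurable_compose[OF set_root_measurable_at tree_weight_measurable])

lemma level_restrict_measurable:
  "(\<lambda>g. restrict g (level q k)) \<in> torus (nodes_upto q k) \<rightarrow>\<^sub>M torus (level q k)"
  by (rule measurable_restrict_subset[OF level_subset])

lemma merge_root:
  "(merge (nodes_upto q k - {[]}) (level q (Suc k)) (g, y))([] := x)
    = merge (nodes_upto q k) (level q (Suc k)) (g([] := x), y)"
  using root_in_nodes by (auto simp: merge_def fun_eq_iff level_def)

text \<open>The Markov property for densities: the new level is tied to the older ones only by the
  labels of level \<open>k\<close>, so its factor has the form that \<open>kernel_avg\<close>
  integrates.\<close>

lemma tree_weight_Suc:
  "tree_weight q \<beta> (Suc k) ((merge (nodes_upto q k - {[]}) (level q (Suc k)) (g, y))([] := x))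
    = tree_weight q \<beta> k (g([] := x))
      * (\<Prod>u\<in>level q (Suc k). phi \<beta> (restrict (g([] := x)) (level q k) (butlast u)) (y u))"
proof -
  let ?m = "merge (nodes_upto q k) (level q (Suc k)) (g([] := x), y)"
  have m1: "?m v = (g([] := x)) v" if "v \<in> nodes_upto q k" for v
    using that by (simp add: merge_def)
  have m2: "?m v = y v" if "v \<in> level q (Suc k)" for v
    using that by (auto simp: merge_def level_def nodes_upto_def)
  have "tree_weight q \<beta> (Suc k) ?m
    = (\<Prod>v\<in>nodes_upto q k - {[]}. phi \<beta> (?m (butlast v)) (?m v)) * (\<Prod>v\<in>level q (Suc k). phi \<beta> (?m (butlast v)) (?m v))"
    unfolding tree_weight_def nodes_upto_Suc
    by (rule prod.union_disjoint) (auto simp: finite_nodes_upto finite_level nodes_level_disjoint)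
  also have "(\<Prod>v\<in>nodes_upto q k - {[]}. phi \<beta> (?m (butlast v)) (?m v)) = tree_weight q \<beta> k (g([] := x))"
    unfolding tree_weight_def by (intro prod.cong refl) (simp add: m1 butlast_in_nodes del: fun_upd_apply)
  also have "(\<Prod>v\<in>level q (Suc k). phi \<beta> (?m (butlast v)) (?m v))
    = (\<Prod>u\<in>level q (Suc k). phi \<beta> (restrict (g([] := x)) (level q k) (butlast u)) (y u))"
    using level_subset[of q k]
    by (intro prod.cong refl) (auto simp: m1 m2 butlast_in_level subset_iff simp del: fun_upd_apply)
  finally show ?thesis by (simp only: merge_root)
qed

lemma restrict_merge_level:
  assumes "y \<in> extensional (level q (Suc k))"
  shows "restrict ((merge (nodes_upto q k - {[]}) (level q (Suc k)) (g, y))([] := x)) (level q (Suc k)) = y"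
  using assms by (auto simp: merge_def fun_eq_iff level_def nodes_upto_def extensional_def)

text \<open>Levels are integrated out from the leaves upwards, each transition density having mass
  1. The integral is the nonnegative one because integrability is derived from it afterwards, in
  \<open>tree_weight_density\<close>.\<close>

lemma nn_integral_tree_weight:
  assumes "\<beta> > 0"
  shows "(\<integral>\<^sup>+g. ennreal (tree_weight q \<beta> k (g([] := x))) \<partial>torus (nodes_upto q k - {[]})) = 1"
proof (induction k)
  case 0
  have [simp]: "nodes_upto q 0 - {[]} = {}" by (auto simp: nodes_upto_def)
  interpret product_prob_space "\<lambda>_. sigmaS1" by (rule product_prob_space_sigmaS1)
  show ?case by (simp add: tree_weight_def PiM_empty)
next
  case (Suc k)
  interpret product_prob_space "\<lambda>_. sigmaS1" by (rule product_prob_space_sigmaS1)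
  have "(\<integral>\<^sup>+g. ennreal (tree_weight q \<beta> (Suc k) (g([] := x))) \<partial>torus (nodes_upto q (Suc k) - {[]}))
    = (\<integral>\<^sup>+g. (\<integral>\<^sup>+y. ennreal (tree_weight q \<beta> (Suc k) ((merge (nodes_upto q k - {[]}) (level q (Suc k)) (g, y))([] := x)))
        \<partial>torus (level q (Suc k))) \<partial>torus (nodes_upto q k - {[]}))"
    unfolding nodes_upto_Suc
    using tree_weight_measurable_at[where x=x and q=q and k="Suc k" and \<beta>=\<beta>]
    by (intro product_nn_integral_fold) (auto simp: finite_nodes_upto finite_level nodes_level_disjoint nodes_upto_Suc)
  also have "\<dots> = (\<integral>\<^sup>+g. ennreal (tree_weight q \<beta> k (g([] := x))) \<partial>torus (nodes_upto q k - {[]}))"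
  proof (rule nn_integral_cong)
    fix g
    let ?P = "\<lambda>y. \<Prod>u\<in>level q (Suc k). phi \<beta> (restrict (g([] := x)) (level q k) (butlast u)) (y u)"
    note dens = kernel_density[OF assms finite_level[of q "Suc k"], of "\<lambda>u. restrict (g([] := x)) (level q k) (butlast u)"]
    have "(\<integral>\<^sup>+y. ennreal (?P y) \<partial>torus (level q (Suc k))) = 1"
      using dens by (subst nn_integral_eq_integral) auto
    then show "(\<integral>\<^sup>+y. ennreal (tree_weight q \<beta> (Suc k) ((merge (nodes_upto q k - {[]}) (level q (Suc k)) (g, y))([] := x)))
        \<partial>torus (level q (Suc k))) = ennreal (tree_weight q \<beta> k (g([] := x)))"
      unfolding tree_weight_Suc using dens(1)
      by (simp add: ennreal_mult tree_weight_nonneg prod_nonneg nn_integral_cmult)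
  qed
  finally show ?case by (simp only: Suc.IH)
qed

lemma tree_weight_density:
  assumes "\<beta> > 0"
  shows "integrable (torus (nodes_upto q k - {[]})) (\<lambda>g. tree_weight q \<beta> k (g([] := x)))"
    and "(\<integral>g. tree_weight q \<beta> k (g([] := x)) \<partial>torus (nodes_upto q k - {[]})) = 1"
proof -
  note m = tree_weight_measurable_at[where x=x and q=q and k=k and \<beta>=\<beta>]
  show "integrable (torus (nodes_upto q k - {[]})) (\<lambda>g. tree_weight q \<beta> k (g([] := x)))"
    using m nn_integral_tree_weight[OF assms, of q k x]
    by (intro integrableI_nonneg) (auto simp: tree_weight_nonneg)
  show "(\<integral>g. tree_weight q \<beta> k (g([] := x)) \<partial>torus (nodes_upto q k - {[]})) = 1"
    using m nn_integral_tree_weight[OF assms, of q k x]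
    by (subst integral_eq_nn_integral) (auto simp: tree_weight_nonneg)
qed

lemma level_read_measurable:
  assumes "F \<in> borel_measurable (torus (level q k))"
  shows "(\<lambda>g. F (restrict (g([] := x)) (level q k))) \<in> borel_measurable (torus (nodes_upto q k - {[]}))"
  using measurable_compose[OF measurable_compose[OF set_root_measurable_at level_restrict_measurable] assms] .

text \<open>Tower property: conditioning on level \<open>k\<close> replaces a function of level
  \<open>Suc k\<close> by its kernel average.\<close>

lemma root_avg_Suc:
  assumes "\<beta> > 0" and F: "F \<in> borel_measurable (torus (level q (Suc k)))"
    "\<And>y. y \<in> extensional (level q (Suc k)) \<Longrightarrow> \<bar>F y\<bar> \<le> B"
  shows "root_avg q \<beta> (Suc k) F x
    = root_avg q \<beta> k (\<lambda>y. kernel_avg \<beta> (level q (Suc k)) (\<lambda>u. y (butlast u)) F) x"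
proof -
  interpret product_prob_space "\<lambda>_. sigmaS1" by (rule product_prob_space_sigmaS1)
  let ?H = "\<lambda>g. tree_weight q \<beta> (Suc k) (g([] := x)) * F (restrict (g([] := x)) (level q (Suc k)))"
  have "integrable (torus (nodes_upto q (Suc k) - {[]})) ?H"
    by (rule integrable_mult_bounded[OF tree_weight_density(1)[OF assms(1)] level_read_measurable[OF F(1)]])
      (auto intro!: F(2))
  then have "root_avg q \<beta> (Suc k) F x
    = (\<integral>g. (\<integral>y. ?H (merge (nodes_upto q k - {[]}) (level q (Suc k)) (g, y)) \<partial>torus (level q (Suc k)))
        \<partial>torus (nodes_upto q k - {[]}))"
    unfolding root_avg_def nodes_upto_Suc
    by (intro product_integral_fold) (auto simp: finite_nodes_upto finite_level nodes_level_disjoint)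
  also have "\<dots> = root_avg q \<beta> k (\<lambda>y. kernel_avg \<beta> (level q (Suc k)) (\<lambda>u. y (butlast u)) F) x"
    unfolding root_avg_def
  proof (rule Bochner_Integration.integral_cong[OF refl])
    fix g
    have "(\<integral>y. ?H (merge (nodes_upto q k - {[]}) (level q (Suc k)) (g, y)) \<partial>torus (level q (Suc k)))
      = (\<integral>y. tree_weight q \<beta> k (g([] := x))
          * ((\<Prod>u\<in>level q (Suc k). phi \<beta> (restrict (g([] := x)) (level q k) (butlast u)) (y u)) * F y) \<partial>torus (level q (Suc k)))"
      by (rule Bochner_Integration.integral_cong[OF refl])
        (simp only: space_torus tree_weight_Suc restrict_merge_level mult.assoc)
    then show "(\<integral>y. ?H (merge (nodes_upto q k - {[]}) (level q (Suc k)) (g, y)) \<partial>torus (level q (Suc k)))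
      = tree_weight q \<beta> k (g([] := x))
        * kernel_avg \<beta> (level q (Suc k)) (\<lambda>u. restrict (g([] := x)) (level q k) (butlast u)) F"
      by (simp only: kernel_avg_def integral_mult_right_zero)
  qed
  finally show ?thesis .
qed

lemma kernel_avg_level_measurable:
  assumes [measurable]: "F \<in> borel_measurable (torus (level q (Suc k)))"
  shows "(\<lambda>y. kernel_avg \<beta> (level q (Suc k)) (\<lambda>u. y (butlast u)) F) \<in> borel_measurable (torus (level q k))"
proof -
  interpret product_prob_space "\<lambda>_. sigmaS1" by (rule product_prob_space_sigmaS1)
  interpret finite_product_sigma_finite "\<lambda>_. sigmaS1" "level q (Suc k)"
    by standard (rule finite_level)
  show ?thesis
    unfolding kernel_avg_def
  proof (rule borel_measurable_lebesgue_integral, unfold case_prod_beta', intro borel_measurable_times borel_measurable_prod phi_measurable)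
    fix u assume u[measurable]: "u \<in> level q (Suc k)"
    have [measurable]: "butlast u \<in> level q k" by (rule butlast_in_level[OF u])
    show "(\<lambda>p. fst p (butlast u)) \<in> borel_measurable (torus (level q k) \<Otimes>\<^sub>M torus (level q (Suc k)))"
      "(\<lambda>p. snd p u) \<in> borel_measurable (torus (level q k) \<Otimes>\<^sub>M torus (level q (Suc k)))"
      by measurable
  qed measurable
qed

lemma kernel_avg_bounded:
  assumes "\<beta> > 0" "finite J" "F \<in> borel_measurable (torus J)" "\<And>z. z \<in> extensional J \<Longrightarrow> \<bar>F z\<bar> \<le> B"
  shows "\<bar>kernel_avg \<beta> J x F\<bar> \<le> B"
  unfolding kernel_avg_def
  by (intro weighted_avg_bound kernel_density) (use assms in \<open>auto simp: space_torus\<close>)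

text \<open>Each pass replaces \<open>F\<close> by its kernel average one level closer to the root,
  at a cost of \<open>lambda_phi \<beta>\<close> for the transitions and \<open>q\<close> for the
  children of a node; hence the induction runs over all \<open>F\<close> and \<open>c\<close>. At
  depth 0 the sum is the chord between the two root labels.\<close>

lemma root_avg_contract:
  assumes "\<beta> > 0" "F \<in> borel_measurable (torus (level q k))"
    "\<And>y. y \<in> extensional (level q k) \<Longrightarrow> \<bar>F y\<bar> \<le> B"
    "\<And>y y'. y \<in> extensional (level q k) \<Longrightarrow> y' \<in> extensional (level q k)
      \<Longrightarrow> \<bar>F y - F y'\<bar> \<le> c * (\<Sum>u\<in>level q k. chord (y u) (y' u))"
  shows "\<bar>root_avg q \<beta> k F x - root_avg q \<beta> k F x'\<bar> \<le> c * (real q * lambda_phi \<beta>) ^ k * chord x x'"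
  using assms(2-)
proof (induction k arbitrary: F c)
  case 0
  interpret product_prob_space "\<lambda>_. sigmaS1" by (rule product_prob_space_sigmaS1)
  have [simp]: "nodes_upto q 0 - {[]} = {}" "level q 0 = {[]}" by (auto simp: nodes_upto_def level_def)
  define r where "r x = restrict ((\<lambda>_. undefined)([] := x)) {[] :: nat list}" for x :: real
  have eq: "root_avg q \<beta> 0 F x = F (r x)" for x
    by (simp add: root_avg_def tree_weight_def PiM_empty lebesgue_integral_count_space_finite r_def restrict_def fun_upd_def)
  have "\<bar>F (r x) - F (r x')\<bar> \<le> c * (\<Sum>u\<in>level q 0. chord (r x u) (r x' u))"
    by (rule "0.prems"(3)) (simp_all add: r_def extensional_def)
  moreover have "r x [] = x" for x by (simp add: r_def)
  ultimately show ?case by (simp add: eq)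
next
  case (Suc k)
  note F = Suc.prems
  let ?Q = "\<lambda>y. kernel_avg \<beta> (level q (Suc k)) (\<lambda>u. y (butlast u)) F"
  have "\<bar>root_avg q \<beta> k ?Q x - root_avg q \<beta> k ?Q x'\<bar>
    \<le> (c * lambda_phi \<beta> * real q) * (real q * lambda_phi \<beta>) ^ k * chord x x'"
  proof (rule Suc.IH)
    fix y y' :: "nat list \<Rightarrow> real"
    have "\<bar>?Q y - ?Q y'\<bar> \<le> c * lambda_phi \<beta> * (\<Sum>u\<in>level q (Suc k). chord (y (butlast u)) (y' (butlast u)))"
      by (rule kernel_avg_contract[OF assms(1) finite_level F])
    also have "\<dots> = (c * lambda_phi \<beta> * real q) * (\<Sum>u\<in>level q k. chord (y u) (y' u))"
      by (subst sum_level_Suc[where f="\<lambda>v. chord (y v) (y' v)"]) simp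
    finally show "\<bar>?Q y - ?Q y'\<bar> \<le> (c * lambda_phi \<beta> * real q) * (\<Sum>u\<in>level q k. chord (y u) (y' u))" .
  qed (use F assms(1) in \<open>auto intro!: kernel_avg_level_measurable kernel_avg_bounded finite_level\<close>)
  then show ?case using root_avg_Suc[OF assms(1) F(1,2)] by (simp add: mult_ac)
qed

text \<open>The lowest level is spent on smoothing, which explains the exponent \<open>k\<close> at
  depth \<open>Suc k\<close> and the constant in front; the \<open>q\<close> in that constant counts
  the children at this level. Finally \<open>chord x x' \<le> 1\<close> removes the root
  labels.\<close>

lemma root_avg_influence:
  assumes "\<beta> > 0" "F \<in> borel_measurable (torus (level q (Suc k)))"
    "\<And>y. y \<in> extensional (level q (Suc k)) \<Longrightarrow> \<bar>F y\<bar> \<le> 1"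
  shows "\<bar>root_avg q \<beta> (Suc k) F x - root_avg q \<beta> (Suc k) F x'\<bar>
    \<le> (2 * pi * normal_density 0 (sqrt \<beta>) 0 * real q) * (real q * lambda_phi \<beta>) ^ k"
proof -
  let ?Q = "\<lambda>y. kernel_avg \<beta> (level q (Suc k)) (\<lambda>u. y (butlast u)) F"
  let ?C = "2 * pi * normal_density 0 (sqrt \<beta>) 0 * real q"
  have "\<bar>root_avg q \<beta> k ?Q x - root_avg q \<beta> k ?Q x'\<bar> \<le> ?C * (real q * lambda_phi \<beta>) ^ k * chord x x'"
  proof (rule root_avg_contract[OF assms(1)])
    fix y y' :: "nat list \<Rightarrow> real"
    have "\<bar>?Q y - ?Q y'\<bar> \<le> 2 * 1 * (pi * normal_density 0 (sqrt \<beta>) 0) * (\<Sum>u\<in>level q (Suc k). chord (y (butlast u)) (y' (butlast u)))"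
      by (rule kernel_avg_smooth[OF assms(1) finite_level assms(2,3)])
    also have "\<dots> = ?C * (\<Sum>u\<in>level q k. chord (y u) (y' u))"
      by (subst sum_level_Suc[where f="\<lambda>v. chord (y v) (y' v)"]) simp
    finally show "\<bar>?Q y - ?Q y'\<bar> \<le> ?C * (\<Sum>u\<in>level q k. chord (y u) (y' u))" .
  qed (use assms in \<open>auto intro!: kernel_avg_level_measurable kernel_avg_bounded finite_level\<close>)
  also have "\<dots> \<le> ?C * (real q * lambda_phi \<beta>) ^ k * 1"
    using chord_props(2)[of x x'] by (intro mult_left_mono) (auto simp: lambda_phi_eq[OF assms(1)])
  finally show ?thesis using root_avg_Suc[OF assms] by simp
qed

section \<open>Posterior distribution of the root\<close>

text \<open>Equality of measures is reduced to countably many sets, so that identities each valid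
  almost everywhere can be combined.\<close>

lemma measure_eqI_rational_rays:
  fixes M N :: "real measure"
  assumes "finite_measure M" and sets: "sets M = sets borel" "sets N = sets borel"
    and eq: "\<And>r :: rat. emeasure M {of_rat r<..} = emeasure N {of_rat r<..}"
  shows "M = N"
proof (rule measure_eqI_generator_eq)
  let ?F = "\<lambda>r :: rat. {of_rat r :: real<..}"
  have "(borel :: real measure) = sigma UNIV (range ?F)"
  proof (rule borel_eq_sigmaI1[OF borel_Ioi])
    fix S :: "real set" assume "S \<in> range greaterThan"
    then obtain a where S: "S = {a<..}" by auto
    have "{a<..} = (\<Union>r\<in>{r. a < of_rat r}. ?F r)"
    proof (intro set_eqI iffI)
      fix x assume "x \<in> {a<..}"
      then obtain r where "a < of_rat r" "of_rat r < x" using of_rat_dense[of a x] by auto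
      then show "x \<in> (\<Union>r\<in>{r. a < of_rat r}. ?F r)" by auto
    qed auto
    moreover have "(\<Union>r\<in>{r. a < of_rat r}. ?F r) \<in> sets (sigma UNIV (range ?F))"
      by (rule sets.countable_UN'') (auto intro: countableI_type)
    ultimately show "S \<in> sets (sigma UNIV (range ?F))" unfolding S by simp
  qed auto
  then have "sets borel = sigma_sets UNIV (range ?F)"
    by (metis sets_measure_of Pow_UNIV top_greatest)
  then show "sets M = sigma_sets UNIV (range ?F)" "sets N = sigma_sets UNIV (range ?F)"
    using sets by auto
  show "Int_stable (range ?F)"
  proof (rule Int_stableI)
    fix a b assume "a \<in> range ?F" "b \<in> range ?F"
    then obtain r s where "a = ?F r" "b = ?F s" by auto
    then have "a \<inter> b = ?F (max r s)" by (auto simp: max_def of_rat_less_eq split: if_splits)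
      (meson of_rat_less_eq le_less_trans not_le order_less_imp_le)+
    then show "a \<inter> b \<in> range ?F" by blast
  qed
  show "range (\<lambda>n. ?F (- of_nat n)) \<subseteq> range ?F" by auto
  show "(\<Union>n. ?F (- of_nat n)) = UNIV"
  proof (intro set_eqI iffI UNIV_I)
    fix x :: real
    obtain n :: nat where "- x < real n" using reals_Archimedean2 by blast
    then have "x \<in> ?F (- of_nat n)" by (simp add: of_rat_minus)
    then show "x \<in> (\<Union>n. ?F (- of_nat n))" by blast
  qed
  show "emeasure M (?F (- of_nat n)) \<noteq> \<infinity>" for n
    using assms(1) by (simp add: finite_measure.emeasure_finite)
qed (use eq in auto)

lemma prob_space_torus: "prob_space (torus J)"
  by (rule prob_space_PiM) (rule prob_space_sigmaS1)

lemma tree_law_eq: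
  "tree_law q \<beta> k = density (torus (nodes_upto q k)) (\<lambda>g. ennreal (tree_weight q \<beta> k g))"
  unfolding tree_law_def tree_weight_def by (simp add: prod_ennreal)

lemma merge_singleton_root:
  assumes "g \<in> extensional (nodes_upto q k - {[]})"
  shows "merge {[]} (nodes_upto q k - {[]}) (u, g) = g([] := u [])"
  using assms root_in_nodes by (auto simp: merge_def fun_eq_iff extensional_def)

lemma nodes_upto_insert_root: "nodes_upto q k = {[]} \<union> (nodes_upto q k - {[]})"
  using root_in_nodes by auto

lemma integrable_tree_weight:
  assumes "\<beta> > 0"
  shows "integrable (torus (nodes_upto q k)) (tree_weight q \<beta> k)"
    and "(\<integral>\<^sup>+g. ennreal (tree_weight q \<beta> k g) \<partial>torus (nodes_upto q k)) = 1"
proof -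
  interpret product_prob_space "\<lambda>_. sigmaS1" by (rule product_prob_space_sigmaS1)
  have "(\<integral>\<^sup>+g. ennreal (tree_weight q \<beta> k g) \<partial>torus ({[]} \<union> (nodes_upto q k - {[]})))
    = (\<integral>\<^sup>+u. (\<integral>\<^sup>+g. ennreal (tree_weight q \<beta> k (merge {[]} (nodes_upto q k - {[]}) (u, g))) \<partial>torus (nodes_upto q k - {[]})) \<partial>torus {[] :: nat list})"
    using tree_weight_measurable[of q \<beta> k]
    by (intro product_nn_integral_fold) (auto simp: finite_nodes_upto nodes_upto_insert_root[symmetric] insert_absorb[OF root_in_nodes])
  also have "\<dots> = (\<integral>\<^sup>+u. (\<integral>\<^sup>+g. ennreal (tree_weight q \<beta> k (g([] := u []))) \<partial>torus (nodes_upto q k - {[]})) \<partial>torus {[] :: nat list})"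
    by (rule nn_integral_cong, rule nn_integral_cong) (simp only: merge_singleton_root space_torus)
  also have "\<dots> = 1"
    using prob_space.emeasure_space_1[OF prob_space_torus[of "{[] :: nat list}"]]
    by (simp only: nn_integral_tree_weight[OF assms] nn_integral_const) simp
  finally show 1: "(\<integral>\<^sup>+g. ennreal (tree_weight q \<beta> k g) \<partial>torus (nodes_upto q k)) = 1"
    by (simp only: nodes_upto_insert_root[symmetric])
  show "integrable (torus (nodes_upto q k)) (tree_weight q \<beta> k)"
    using tree_weight_measurable 1
    by (intro integrableI_nonneg) (auto simp: tree_weight_nonneg)
qed

lemma prob_space_tree_law:
  assumes "\<beta> > 0"
  shows "prob_space (tree_law q \<beta> k)"
proof
  have "emeasure (tree_law q \<beta> k) (space (torus (nodes_upto q k))) = 1"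
    unfolding tree_law_eq using tree_weight_measurable[of q \<beta> k] integrable_tree_weight(2)[OF assms, of q k]
    by (subst emeasure_density) (auto cong: nn_integral_cong)
  then show "emeasure (tree_law q \<beta> k) (space (tree_law q \<beta> k)) = 1"
    by (simp add: tree_law_eq)
qed

text \<open>Fubini with the root separated. The root carries no transition factor, so its label is
  integrated against \<open>sigmaS1\<close> itself.\<close>

lemma tree_law_expectation:
  fixes \<Psi> :: "real \<Rightarrow> (nat list \<Rightarrow> real) \<Rightarrow> real"
  assumes "\<beta> > 0" and \<Psi>: "(\<lambda>p. \<Psi> (fst p) (snd p)) \<in> borel_measurable (sigmaS1 \<Otimes>\<^sub>M torus (level q k))"
    "\<And>x y. \<bar>\<Psi> x y\<bar> \<le> B"
  shows "(\<integral>g. \<Psi> (g []) (restrict g (level q k)) \<partial>tree_law q \<beta> k)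
    = (\<integral>x. root_avg q \<beta> k (\<Psi> x) x \<partial>sigmaS1)"
proof -
  interpret product_prob_space "\<lambda>_. sigmaS1" by (rule product_prob_space_sigmaS1)
  interpret N': prob_space "torus (nodes_upto q k - {[]})" by (rule prob_space_torus)
  define H where "H g = tree_weight q \<beta> k g * \<Psi> (g []) (restrict g (level q k))" for g
  have [measurable]: "[] \<in> nodes_upto q k" by (rule root_in_nodes)
  have m: "(\<lambda>g. \<Psi> (g []) (restrict g (level q k))) \<in> borel_measurable (torus (nodes_upto q k))"
  proof -
    have "(\<lambda>g. (g [], restrict g (level q k))) \<in> torus (nodes_upto q k) \<rightarrow>\<^sub>M sigmaS1 \<Otimes>\<^sub>M torus (level q k)"
      using level_restrict_measurable by measurable
    from measurable_compose[OF this \<Psi>(1)] show ?thesis by simp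
  qed
  have Hm: "H \<in> borel_measurable (torus (nodes_upto q k))"
    unfolding H_def[abs_def] using m tree_weight_measurable by measurable
  have Hi: "integrable (torus (nodes_upto q k)) H"
    unfolding H_def[abs_def]
    by (rule integrable_mult_bounded[OF integrable_tree_weight(1)[OF assms(1)] m \<Psi>(2)])
  have "(\<integral>g. \<Psi> (g []) (restrict g (level q k)) \<partial>tree_law q \<beta> k) = integral\<^sup>L (torus ({[]} \<union> (nodes_upto q k - {[]}))) H"
    unfolding tree_law_eq nodes_upto_insert_root[symmetric] H_def[abs_def]
    by (subst integral_density) (auto simp: m tree_weight_measurable tree_weight_nonneg)
  also have "\<dots> = (\<integral>u. (\<integral>g. H (merge {[]} (nodes_upto q k - {[]}) (u, g)) \<partial>torus (nodes_upto q k - {[]})) \<partial>torus {[] :: nat list})"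
    using Hi by (intro product_integral_fold) (auto simp: finite_nodes_upto nodes_upto_insert_root[symmetric] insert_absorb[OF root_in_nodes])
  also have "\<dots> = (\<integral>u. (\<integral>g. H (g([] := u [])) \<partial>torus (nodes_upto q k - {[]})) \<partial>torus {[] :: nat list})"
    by (rule Bochner_Integration.integral_cong[OF refl], rule Bochner_Integration.integral_cong[OF refl])
      (simp only: merge_singleton_root space_torus)
  also have "\<dots> = (\<integral>x. (\<integral>g. H (g([] := x)) \<partial>torus (nodes_upto q k - {[]})) \<partial>sigmaS1)"
  proof (rule product_integral_singleton)
    show "(\<lambda>x. \<integral>g. H (g([] := x)) \<partial>torus (nodes_upto q k - {[]})) \<in> borel_measurable sigmaS1"
      using measurable_compose[OF set_root_measurable Hm]
      by (intro N'.borel_measurable_lebesgue_integral) (simp add: case_prod_beta')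
  qed
  also have "\<dots> = (\<integral>x. root_avg q \<beta> k (\<Psi> x) x \<partial>sigmaS1)"
    by (simp add: H_def root_avg_def)
  finally show ?thesis .
qed

lemma sets_torus: "sets (torus J) = sets (PiM J (\<lambda>_. borel))"
  by (rule sets_PiM_cong) (auto simp: sets_sigmaS1)

lemma tv_dist_le_1:
  assumes "prob_space M" "prob_space N"
  shows "tv_dist M N \<le> 1"
  unfolding tv_dist_def
proof (rule cSUP_least)
  show "\<bar>measure M A - measure N A\<bar> \<le> 1" for A
    using prob_space.prob_le_1[OF assms(1), of A] prob_space.prob_le_1[OF assms(2), of A]
      measure_nonneg[of M A] measure_nonneg[of N A] by linarith
qed auto

lemma tv_dist_nonneg:
  assumes "prob_space M" "prob_space N"
  shows "tv_dist M N \<ge> 0"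
proof -
  have "\<bar>measure M {} - measure N {}\<bar> \<le> tv_dist M N"
    unfolding tv_dist_def
  proof (rule cSUP_upper)
    show "bdd_above ((\<lambda>A. \<bar>measure M A - measure N A\<bar>) ` sets M)"
    proof (rule bdd_aboveI2)
      show "\<bar>measure M A - measure N A\<bar> \<le> 1" for A
        using prob_space.prob_le_1[OF assms(1), of A] prob_space.prob_le_1[OF assms(2), of A]
          measure_nonneg[of M A] measure_nonneg[of N A] by linarith
    qed
  qed simp
  then show ?thesis by simp
qed

section \<open>Joint density of the root and the leaves\<close>

context
  fixes q k :: nat and \<beta> :: real
  assumes kpos: "k > 0" and \<beta>pos: "\<beta> > 0"
begin

private abbreviation (input) leaves :: "nat list set" where
  "leaves \<equiv> level q k"

private abbreviation (input) inner_nodes :: "nat list set" where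
  "inner_nodes \<equiv> nodes_upto q k - {[]} - level q k"

text \<open>The likelihood of the leaf labels \<open>y\<close> for the root label \<open>x\<close>:
  the labels strictly between root and leaves are integrated out.\<close>

definition leaf_density :: "real \<Rightarrow> (nat list \<Rightarrow> real) \<Rightarrow> real" where
  "leaf_density x y = (\<integral>r. tree_weight q \<beta> k ((merge leaves inner_nodes (y, r))([] := x)) \<partial>torus inner_nodes)"

definition leaf_marginal :: "(nat list \<Rightarrow> real) \<Rightarrow> real" where
  "leaf_marginal y = (\<integral>x. leaf_density x y \<partial>sigmaS1)"

text \<open>The posterior density is \<open>leaf_density x y / leaf_marginal y\<close> and the prior
  density is 1. This is the L1 distance of the two, multiplied by \<open>leaf_marginal y\<close>: no
  division occurs, and integrating over \<open>y\<close> directly gives the expected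
  distance.\<close>

definition posterior_gap :: "(nat list \<Rightarrow> real) \<Rightarrow> real" where
  "posterior_gap y = (\<integral>x. \<bar>leaf_density x y - leaf_marginal y\<bar> \<partial>sigmaS1)"

text \<open>\<open>k > 0\<close> separates the root from the leaves. At depth 0 they coincide, and
  the posterior is a point mass without density.\<close>

private lemma nodes_split: "leaves \<union> inner_nodes = nodes_upto q k - {[]}" "leaves \<inter> inner_nodes = {}"
  using level_subset[of q k] kpos by (auto simp: level_def)

lemma leaf_density_nonneg: "leaf_density x y \<ge> 0"
  by (simp add: leaf_density_def tree_weight_nonneg)

lemma leaf_marginal_nonneg: "leaf_marginal y \<ge> 0"
  by (simp add: leaf_marginal_def leaf_density_nonneg)

lemma leaf_density_measurable:
  "(\<lambda>p. leaf_density (fst p) (snd p)) \<in> borel_measurable (sigmaS1 \<Otimes>\<^sub>M torus leaves)"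
proof -
  interpret prob_space "torus inner_nodes" by (rule prob_space_torus)
  have "(\<lambda>z. (fst (fst z), merge leaves inner_nodes (snd (fst z), snd z)))
      \<in> (sigmaS1 \<Otimes>\<^sub>M torus leaves) \<Otimes>\<^sub>M torus inner_nodes \<rightarrow>\<^sub>M sigmaS1 \<Otimes>\<^sub>M torus (leaves \<union> inner_nodes)"
    by measurable
  from measurable_compose[OF measurable_compose[OF this[unfolded nodes_split] set_root_measurable] tree_weight_measurable]
  show ?thesis
    unfolding leaf_density_def by (intro borel_measurable_lebesgue_integral) (simp add: case_prod_beta')
qed

lemma leaf_density_section [measurable]: "leaf_density x \<in> borel_measurable (torus leaves)"
  using measurable_compose[OF measurable_Pair1' leaf_density_measurable, of x]
  by (simp add: space_sigmaS1)

lemma root_avg_conv_leaf_density: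
  assumes F: "F \<in> borel_measurable (torus leaves)" "\<And>y. y \<in> extensional leaves \<Longrightarrow> \<bar>F y\<bar> \<le> B"
  shows "root_avg q \<beta> k F x = (\<integral>y. leaf_density x y * F y \<partial>torus leaves)"
proof -
  interpret product_prob_space "\<lambda>_. sigmaS1" by (rule product_prob_space_sigmaS1)
  let ?H = "\<lambda>g. tree_weight q \<beta> k (g([] := x)) * F (restrict (g([] := x)) leaves)"
  have "integrable (torus (nodes_upto q k - {[]})) ?H"
    by (rule integrable_mult_bounded[OF tree_weight_density(1)[OF \<beta>pos] level_read_measurable[OF F(1)]])
      (auto intro!: F(2))
  then have "integrable (torus (leaves \<union> inner_nodes)) ?H" by (simp only: nodes_split(1))
  then have "integral\<^sup>L (torus (leaves \<union> inner_nodes)) ?H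
    = (\<integral>y. (\<integral>r. ?H (merge leaves inner_nodes (y, r)) \<partial>torus inner_nodes) \<partial>torus leaves)"
    by (intro product_integral_fold[OF nodes_split(2)]) (simp_all only: finite_nodes_upto finite_level finite_Diff)
  then have "root_avg q \<beta> k F x
    = (\<integral>y. (\<integral>r. ?H (merge leaves inner_nodes (y, r)) \<partial>torus inner_nodes) \<partial>torus leaves)"
    by (simp only: root_avg_def nodes_split(1))
  also have "\<dots> = (\<integral>y. leaf_density x y * F y \<partial>torus leaves)"
  proof (rule Bochner_Integration.integral_cong[OF refl])
    fix y assume "y \<in> space (torus leaves)"
    then have "restrict ((merge leaves inner_nodes (y, r))([] := x)) leaves = y" for r
      using kpos by (auto simp: space_torus merge_def fun_eq_iff level_def extensional_def)
    then show "(\<integral>r. ?H (merge leaves inner_nodes (y, r)) \<partial>torus inner_nodes) = leaf_density x y * F y"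
      by (simp only: leaf_density_def integral_mult_left_zero)
  qed
  finally show ?thesis .
qed

lemma leaf_density_integral: "(\<integral>y. leaf_density x y \<partial>torus leaves) = 1"
  using root_avg_conv_leaf_density[of "\<lambda>_. 1" 1 x] tree_weight_density(2)[OF \<beta>pos, of q k x]
  by (simp add: root_avg_def)

lemma leaf_density_integrable: "integrable (torus leaves) (leaf_density x)"
  using leaf_density_integral[of x] not_integrable_integral_eq by fastforce

private lemma pair_sigma_finite_leaves: "pair_sigma_finite sigmaS1 (torus leaves)"
  by (intro pair_sigma_finite.intro prob_space_imp_sigma_finite prob_space_sigmaS1 prob_space_torus)

lemma leaf_density_pair_integrable:
  "integrable (sigmaS1 \<Otimes>\<^sub>M torus leaves) (\<lambda>p. leaf_density (fst p) (snd p))"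
proof -
  interpret pair_sigma_finite sigmaS1 "torus leaves" by (rule pair_sigma_finite_leaves)
  interpret S: prob_space sigmaS1 by (rule prob_space_sigmaS1)
  show ?thesis
    by (rule Fubini_integrable)
      (simp_all add: leaf_density_measurable leaf_density_nonneg leaf_density_integral leaf_density_integrable)
qed

lemma leaf_density_AE_integrable: "AE y in torus leaves. integrable sigmaS1 (\<lambda>x. leaf_density x y)"
proof -
  interpret pair_sigma_finite sigmaS1 "torus leaves" by (rule pair_sigma_finite_leaves)
  show ?thesis using leaf_density_pair_integrable by (intro AE_integrable_snd) (simp add: case_prod_beta')
qed

lemma leaf_marginal_integrable: "integrable (torus leaves) leaf_marginal"
proof -
  interpret pair_sigma_finite sigmaS1 "torus leaves" by (rule pair_sigma_finite_leaves)
  show ?thesis unfolding leaf_marginal_def[abs_def]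
    using leaf_density_pair_integrable by (intro integrable_snd) (simp add: case_prod_beta')
qed

text \<open>The prior being \<open>sigmaS1\<close>, \<open>leaf_density\<close> is also the joint
  density of root and leaves. Product test functions are enough, since a conditional distribution is
  characterised by rectangles.\<close>

lemma expectation_leaf_density:
  assumes h: "h \<in> borel_measurable borel" "\<And>x. \<bar>h x\<bar> \<le> 1"
    and F: "F \<in> borel_measurable (torus leaves)" "\<And>y. \<bar>F y\<bar> \<le> B"
  shows "(\<integral>g. h (g []) * F (restrict g leaves) \<partial>tree_law q \<beta> k)
    = (\<integral>y. F y * (\<integral>x. h x * leaf_density x y \<partial>sigmaS1) \<partial>torus leaves)"
    and "integrable (torus leaves) (\<lambda>y. \<integral>x. h x * leaf_density x y \<partial>sigmaS1)"
proof -
  interpret pair_sigma_finite sigmaS1 "torus leaves" by (rule pair_sigma_finite_leaves)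
  have [measurable]: "h \<in> borel_measurable sigmaS1"
    using h(1) by (simp cong: measurable_cong_sets add: sets_sigmaS1)
  note [measurable] = F(1)
  have bd: "\<bar>h x * F y\<bar> \<le> B" for x y
  proof -
    have "\<bar>h x * F y\<bar> \<le> 1 * \<bar>F y\<bar>" unfolding abs_mult by (intro mult_right_mono h(2)) simp
    then show ?thesis using F(2)[of y] by linarith
  qed
  have int: "integrable (sigmaS1 \<Otimes>\<^sub>M torus leaves) (\<lambda>p. leaf_density (fst p) (snd p) * (h (fst p) * F (snd p)))"
    by (rule integrable_mult_bounded[OF leaf_density_pair_integrable _ bd]) measurable
  have "(\<integral>g. h (g []) * F (restrict g leaves) \<partial>tree_law q \<beta> k)
    = (\<integral>x. root_avg q \<beta> k (\<lambda>y. h x * F y) x \<partial>sigmaS1)"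
    by (rule tree_law_expectation[OF \<beta>pos _ bd]) measurable
  also have "\<dots> = (\<integral>x. (\<integral>y. leaf_density x y * (h x * F y) \<partial>torus leaves) \<partial>sigmaS1)"
    by (rule Bochner_Integration.integral_cong[OF refl], rule root_avg_conv_leaf_density[OF _ bd]) measurable
  also have "\<dots> = (\<integral>y. (\<integral>x. leaf_density x y * (h x * F y) \<partial>sigmaS1) \<partial>torus leaves)"
    using int by (intro Fubini_integral[symmetric]) (simp add: case_prod_beta')
  also have "\<dots> = (\<integral>y. F y * (\<integral>x. h x * leaf_density x y \<partial>sigmaS1) \<partial>torus leaves)"
    by (simp flip: integral_mult_right_zero add: mult_ac)
  finally show "(\<integral>g. h (g []) * F (restrict g leaves) \<partial>tree_law q \<beta> k)
    = (\<integral>y. F y * (\<integral>x. h x * leaf_density x y \<partial>sigmaS1) \<partial>torus leaves)" .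
  have "integrable (sigmaS1 \<Otimes>\<^sub>M torus leaves) (\<lambda>p. leaf_density (fst p) (snd p) * h (fst p))"
    by (rule integrable_mult_bounded[OF leaf_density_pair_integrable _ h(2)]) measurable
  then show "integrable (torus leaves) (\<lambda>y. \<integral>x. h x * leaf_density x y \<partial>sigmaS1)"
    by (intro integrable_snd) (simp add: case_prod_beta' mult.commute)
qed

lemma expectation_leaves:
  assumes F: "F \<in> borel_measurable (torus leaves)" "\<And>y. \<bar>F y\<bar> \<le> B"
  shows "(\<integral>g. F (restrict g leaves) \<partial>tree_law q \<beta> k) = (\<integral>y. F y * leaf_marginal y \<partial>torus leaves)"
  unfolding leaf_marginal_def
  using expectation_leaf_density(1)[of "\<lambda>_. 1" F B] F by simp

text \<open>Duality between L1 and bounded functions: the sign of the difference is itself an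
  admissible test function.\<close>

lemma leaf_density_L1_diff:
  assumes osc: "\<And>F x x'. F \<in> borel_measurable (torus leaves) \<Longrightarrow> (\<And>y. y \<in> extensional leaves \<Longrightarrow> \<bar>F y\<bar> \<le> 1)
      \<Longrightarrow> \<bar>root_avg q \<beta> k F x - root_avg q \<beta> k F x'\<bar> \<le> \<epsilon>"
  shows "(\<integral>y. \<bar>leaf_density x y - leaf_density x' y\<bar> \<partial>torus leaves) \<le> \<epsilon>"
proof -
  define F where "F y = sgn (leaf_density x y - leaf_density x' y)" for y
  have F: "F \<in> borel_measurable (torus leaves)" "\<bar>F y\<bar> \<le> 1" for y
    unfolding F_def[abs_def] by (auto simp: sgn_if)
  have i: "integrable (torus leaves) (\<lambda>y. leaf_density x y * F y)" for x
    by (rule integrable_mult_bounded[OF leaf_density_integrable F])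
  have "(\<integral>y. \<bar>leaf_density x y - leaf_density x' y\<bar> \<partial>torus leaves)
    = (\<integral>y. leaf_density x y * F y - leaf_density x' y * F y \<partial>torus leaves)"
    by (intro Bochner_Integration.integral_cong refl) (simp add: F_def abs_sgn left_diff_distrib[symmetric])
  also have "\<dots> = root_avg q \<beta> k F x - root_avg q \<beta> k F x'"
    using i by (simp add: root_avg_conv_leaf_density[OF F])
  also have "\<dots> \<le> \<epsilon>" using osc[OF F(1) F(2), of x x'] by simp
  finally show ?thesis .
qed

lemma posterior_gap_measurable: "posterior_gap \<in> borel_measurable (torus leaves)"
proof -
  interpret S: prob_space sigmaS1 by (rule prob_space_sigmaS1)
  have [measurable]: "leaf_marginal \<in> borel_measurable (torus leaves)"
    using leaf_marginal_integrable by simp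
  have "(\<lambda>p. leaf_density (snd p) (fst p)) \<in> borel_measurable (torus leaves \<Otimes>\<^sub>M sigmaS1)"
    using measurable_compose[OF measurable_pair_swap' leaf_density_measurable] by (simp add: case_prod_beta')
  then show ?thesis
    unfolding posterior_gap_def[abs_def] by (intro S.borel_measurable_lebesgue_integral) (simp add: case_prod_beta')
qed

text \<open>\<open>leaf_marginal y\<close> is the average of \<open>leaf_density x' y\<close> over a
  second, independent root label \<open>x'\<close>. The triangle inequality takes this average
  outside, and after Fubini the hypothesis applies to each pair of root labels separately.\<close>

lemma posterior_gap_bound:
  assumes "\<epsilon> \<ge> 0" and L1: "\<And>x x'. (\<integral>y. \<bar>leaf_density x y - leaf_density x' y\<bar> \<partial>torus leaves) \<le> \<epsilon>"
  shows "integrable (torus leaves) posterior_gap" "(\<integral>y. posterior_gap y \<partial>torus leaves) \<le> \<epsilon>"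
proof -
  interpret pair_sigma_finite sigmaS1 "torus leaves" by (rule pair_sigma_finite_leaves)
  interpret S: prob_space sigmaS1 by (rule prob_space_sigmaS1)
  interpret T: prob_space "torus leaves" by (rule prob_space_torus)
  interpret SS: pair_sigma_finite "sigmaS1 \<Otimes>\<^sub>M sigmaS1" "torus leaves"
    by (intro pair_sigma_finite.intro prob_space_imp_sigma_finite prob_space_pair prob_space_sigmaS1 prob_space_torus)
  have gap0: "posterior_gap y \<ge> 0" for y by (simp add: posterior_gap_def)
  let ?D = "\<lambda>y x x'. ennreal \<bar>leaf_density x y - leaf_density x' y\<bar>"
  have Dm: "(\<lambda>p. ?D (snd p) (fst (fst p)) (snd (fst p))) \<in> borel_measurable ((sigmaS1 \<Otimes>\<^sub>M sigmaS1) \<Otimes>\<^sub>M torus leaves)"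
  proof -
    have "(\<lambda>p. leaf_density (fst (fst p)) (snd p)) \<in> borel_measurable ((sigmaS1 \<Otimes>\<^sub>M sigmaS1) \<Otimes>\<^sub>M torus leaves)"
      using measurable_compose[OF _ leaf_density_measurable, of "\<lambda>p. (fst (fst p), snd p)" "(sigmaS1 \<Otimes>\<^sub>M sigmaS1) \<Otimes>\<^sub>M torus leaves"]
      by simp
    moreover have "(\<lambda>p. leaf_density (snd (fst p)) (snd p)) \<in> borel_measurable ((sigmaS1 \<Otimes>\<^sub>M sigmaS1) \<Otimes>\<^sub>M torus leaves)"
      using measurable_compose[OF _ leaf_density_measurable, of "\<lambda>p. (snd (fst p), snd p)" "(sigmaS1 \<Otimes>\<^sub>M sigmaS1) \<Otimes>\<^sub>M torus leaves"]
      by simp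
    ultimately show ?thesis by measurable
  qed
  have gap_le: "AE y in torus leaves. ennreal (posterior_gap y) \<le> (\<integral>\<^sup>+p. ?D y (fst p) (snd p) \<partial>(sigmaS1 \<Otimes>\<^sub>M sigmaS1))"
    using leaf_density_AE_integrable AE_space
  proof eventually_elim
    fix y assume i: "integrable sigmaS1 (\<lambda>x. leaf_density x y)" and "y \<in> space (torus leaves)"
    then have m: "(\<lambda>x. leaf_density x y) \<in> borel_measurable sigmaS1" by simp
    have "ennreal (posterior_gap y) = (\<integral>\<^sup>+x. ennreal \<bar>leaf_density x y - leaf_marginal y\<bar> \<partial>sigmaS1)"
      unfolding posterior_gap_def using i by (intro nn_integral_eq_integral[symmetric]) auto
    also have "\<dots> \<le> (\<integral>\<^sup>+x. (\<integral>\<^sup>+x'. ?D y x x' \<partial>sigmaS1) \<partial>sigmaS1)"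
    proof (rule nn_integral_mono)
      fix x
      have "leaf_density x y - leaf_marginal y = (\<integral>x'. leaf_density x y - leaf_density x' y \<partial>sigmaS1)"
        unfolding leaf_marginal_def using i by (simp add: S.prob_space)
      also have "ennreal \<bar>\<dots>\<bar> \<le> (\<integral>\<^sup>+x'. ?D y x x' \<partial>sigmaS1)"
        using integral_norm_bound_ennreal[of sigmaS1 "\<lambda>x'. leaf_density x y - leaf_density x' y"] i by simp
      finally show "ennreal \<bar>leaf_density x y - leaf_marginal y\<bar> \<le> (\<integral>\<^sup>+x'. ?D y x x' \<partial>sigmaS1)" .
    qed
    also have "\<dots> = (\<integral>\<^sup>+p. ?D y (fst p) (snd p) \<partial>(sigmaS1 \<Otimes>\<^sub>M sigmaS1))"
      using m by (subst M1.nn_integral_fst[symmetric]) auto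
    finally show "ennreal (posterior_gap y) \<le> (\<integral>\<^sup>+p. ?D y (fst p) (snd p) \<partial>(sigmaS1 \<Otimes>\<^sub>M sigmaS1))" .
  qed
  have "(\<integral>\<^sup>+y. ennreal (posterior_gap y) \<partial>torus leaves)
    \<le> (\<integral>\<^sup>+y. (\<integral>\<^sup>+p. ?D y (fst p) (snd p) \<partial>(sigmaS1 \<Otimes>\<^sub>M sigmaS1)) \<partial>torus leaves)"
    by (rule nn_integral_mono_AE[OF gap_le])
  also have "\<dots> = (\<integral>\<^sup>+p. (\<integral>\<^sup>+y. ?D y (fst p) (snd p) \<partial>torus leaves) \<partial>(sigmaS1 \<Otimes>\<^sub>M sigmaS1))"
    using Dm by (intro SS.Fubini') (simp add: case_prod_beta')
  also have "\<dots> \<le> (\<integral>\<^sup>+p. ennreal \<epsilon> \<partial>(sigmaS1 \<Otimes>\<^sub>M sigmaS1))"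
  proof (rule nn_integral_mono)
    fix p :: "real \<times> real"
    have "(\<integral>\<^sup>+y. ?D y (fst p) (snd p) \<partial>torus leaves) = ennreal (\<integral>y. \<bar>leaf_density (fst p) y - leaf_density (snd p) y\<bar> \<partial>torus leaves)"
      by (intro nn_integral_eq_integral) (auto intro!: leaf_density_integrable integrable_abs)
    then show "(\<integral>\<^sup>+y. ?D y (fst p) (snd p) \<partial>torus leaves) \<le> ennreal \<epsilon>"
      using L1 by (simp add: ennreal_leI)
  qed
  also have "\<dots> = ennreal \<epsilon>"
    using prob_space.emeasure_space_1[OF prob_space_pair[OF prob_space_sigmaS1 prob_space_sigmaS1]] by simp
  finally have le: "(\<integral>\<^sup>+y. ennreal (posterior_gap y) \<partial>torus leaves) \<le> ennreal \<epsilon>" .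
  show int: "integrable (torus leaves) posterior_gap"
    using le gap0 posterior_gap_measurable by (intro integrableI_nonneg) (auto simp: le_less_trans)
  have "ennreal (\<integral>y. posterior_gap y \<partial>torus leaves) \<le> ennreal \<epsilon>"
    using le int gap0 by (subst nn_integral_eq_integral[symmetric]) auto
  then show "(\<integral>y. posterior_gap y \<partial>torus leaves) \<le> \<epsilon>" using assms(1) by simp
qed

text \<open>The second summand makes up for \<open>x / 0 = 0\<close>; it vanishes almost surely under the law of the leaves.\<close>
definition tv_bound :: "(nat list \<Rightarrow> real) \<Rightarrow> real" where
  "tv_bound y = posterior_gap y / leaf_marginal y + of_bool (leaf_marginal y = 0)"

lemma tv_bound_range: "0 \<le> tv_bound y" "tv_bound y \<le> 3"
proof -
  have g0: "posterior_gap y \<ge> 0" by (simp add: posterior_gap_def)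
  then show "0 \<le> tv_bound y" by (simp add: tv_bound_def leaf_marginal_nonneg)
  show "tv_bound y \<le> 3"
  proof (cases "leaf_marginal y = 0")
    case False
    interpret prob_space sigmaS1 by (rule prob_space_sigmaS1)
    \<comment> \<open>If this function of \<open>x\<close> were not integrable,
      \<open>leaf_marginal y\<close> would be 0 by default.\<close>
    have i: "integrable sigmaS1 (\<lambda>x. leaf_density x y)"
      using False not_integrable_integral_eq unfolding leaf_marginal_def by blast
    have "posterior_gap y \<le> (\<integral>x. leaf_density x y + leaf_marginal y \<partial>sigmaS1)"
      unfolding posterior_gap_def using i leaf_density_nonneg[of _ y] leaf_marginal_nonneg[of y]
      by (intro integral_mono) (auto simp: abs_le_iff)
    also have "\<dots> = 2 * leaf_marginal y" using i by (simp add: leaf_marginal_def[symmetric] prob_space)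
    finally show ?thesis using False leaf_marginal_nonneg[of y] by (simp add: tv_bound_def divide_le_eq)
  qed (simp add: tv_bound_def)
qed

section \<open>Bayes' formula for an arbitrary conditional distribution\<close>

context
  fixes K :: "(nat list \<Rightarrow> real) \<Rightarrow> real measure"
  assumes K: "is_cond_distr (tree_law q \<beta> k) (\<lambda>g. g []) borel (\<lambda>g. restrict g leaves) (PiM leaves (\<lambda>_. borel)) K"
begin

private lemma K_measurable: "K \<in> torus leaves \<rightarrow>\<^sub>M prob_algebra borel"
  using K by (simp add: is_cond_distr_def sets_torus cong: measurable_cong_sets)

private lemma K_prob:
  assumes "y \<in> extensional leaves"
  shows "prob_space (K y)" "sets (K y) = sets borel"
  using measurable_space[OF K_measurable, of y] assms by (auto simp: space_torus space_prob_algebra)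

private lemma K_measure_measurable:
  assumes "A \<in> sets borel"
  shows "(\<lambda>y. measure (K y) A) \<in> borel_measurable (torus leaves)"
  using measurable_compose[OF measurable_prob_algebraD[OF K_measurable] measurable_emeasure_subprob_algebra[OF assms]]
  by (simp add: measure_def)

text \<open>Bayes' formula for one fixed \<open>A\<close>: integrated over any \<open>B\<close>,
  both sides give the probability that the root label is in \<open>A\<close> and the leaf labels are
  in \<open>B\<close>, and densities are unique almost everywhere. The exceptional set still depends
  on \<open>A\<close>.\<close>

private lemma posterior_at:
  assumes A[measurable]: "A \<in> sets borel"
  shows "AE y in torus leaves. measure (K y) A * leaf_marginal y = (\<integral>x. indicator A x * leaf_density x y \<partial>sigmaS1)"
proof (rule density_unique_real)
  have bdA: "\<bar>indicator A x :: real\<bar> \<le> 1" for x by (simp add: indicator_def)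
  have K1: "\<bar>measure (K y) A\<bar> \<le> 1" if "y \<in> extensional leaves" for y
    using prob_space.prob_le_1[OF K_prob(1)[OF that], of A] by simp
  have "integrable (torus leaves) (\<lambda>y. leaf_marginal y * measure (K y) A)"
    by (rule integrable_mult_bounded[OF leaf_marginal_integrable K_measure_measurable[OF A]])
      (use K1 in \<open>auto simp: space_torus\<close>)
  then show "integrable (torus leaves) (\<lambda>y. measure (K y) A * leaf_marginal y)" by (simp add: mult.commute)
  show "integrable (torus leaves) (\<lambda>y. \<integral>x. indicator A x * leaf_density x y \<partial>sigmaS1)"
    by (rule expectation_leaf_density(2)[of "indicator A" "\<lambda>_. 0" 0]) (auto simp: bdA)
  fix B assume B[measurable]: "B \<in> sets (torus leaves)"
  then have Bsub: "B \<subseteq> extensional leaves" using sets.sets_into_space space_torus by metis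
  have "(\<integral>y. indicator B y * (\<integral>x. indicator A x * leaf_density x y \<partial>sigmaS1) \<partial>torus leaves)
    = (\<integral>g. indicator A (g []) * indicator B (restrict g leaves) \<partial>tree_law q \<beta> k)"
    by (rule expectation_leaf_density(1)[of _ _ 1, symmetric]) (auto simp: bdA indicator_def)
  also have "\<dots> = (\<integral>g. indicator {g \<in> space (tree_law q \<beta> k). g [] \<in> A \<and> restrict g leaves \<in> B} g \<partial>tree_law q \<beta> k)"
    by (rule Bochner_Integration.integral_cong) (auto simp: indicator_def)
  also have "\<dots> = measure (tree_law q \<beta> k) {g \<in> space (tree_law q \<beta> k). g [] \<in> A \<and> restrict g leaves \<in> B}"
    by (simp add: Int_absorb2 subset_eq)
  also have "\<dots> = (\<integral>g. indicator B (restrict g leaves) * measure (K (restrict g leaves)) A \<partial>tree_law q \<beta> k)"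
    using K A B by (simp add: is_cond_distr_def sets_torus)
  also have "\<dots> = (\<integral>y. (indicator B y * measure (K y) A) * leaf_marginal y \<partial>torus leaves)"
  proof (rule expectation_leaves)
    show "(\<lambda>y. indicator B y * measure (K y) A) \<in> borel_measurable (torus leaves)"
      using K_measure_measurable[OF A] by measurable
    show "\<bar>indicator B y * measure (K y) A\<bar> \<le> 1" for y
      using K1[of y] Bsub by (auto simp: indicator_def)
  qed
  finally show "(LINT y:B|torus leaves. measure (K y) A * leaf_marginal y)
    = (LINT y:B|torus leaves. \<integral>x. indicator A x * leaf_density x y \<partial>sigmaS1)"
    by (simp add: set_lebesgue_integral_def mult.assoc)
qed

text \<open>The countably many rational rays share one null set. For each \<open>y\<close> outside
  it, both sides are finite measures in \<open>A\<close> that agree on these rays, hence on all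
  Borel sets.\<close>

private lemma posterior_AE:
  "AE y in torus leaves. \<forall>A\<in>sets borel.
     measure (K y) A * leaf_marginal y = (\<integral>x. indicator A x * leaf_density x y \<partial>sigmaS1)"
proof -
  have "AE y in torus leaves. \<forall>r :: rat. measure (K y) {of_rat r<..} * leaf_marginal y
      = (\<integral>x. indicator {of_rat r<..} x * leaf_density x y \<partial>sigmaS1)"
    unfolding AE_all_countable by (intro allI posterior_at) simp
  then show ?thesis using leaf_density_AE_integrable AE_space
  proof eventually_elim
    fix y
    assume r: "\<forall>r :: rat. measure (K y) {of_rat r<..} * leaf_marginal y
      = (\<integral>x. indicator {of_rat r<..} x * leaf_density x y \<partial>sigmaS1)"
      and i: "integrable sigmaS1 (\<lambda>x. leaf_density x y)" and "y \<in> space (torus leaves)"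
    then have y: "y \<in> extensional leaves" by (simp add: space_torus)
    interpret Ky: prob_space "K y" by (rule K_prob(1)[OF y])
    note [measurable_cong] = K_prob(2)[OF y] sets_sigmaS1
    have [measurable]: "(\<lambda>x. leaf_density x y) \<in> borel_measurable sigmaS1" using i by simp
    let ?M = "density (K y) (\<lambda>_. ennreal (leaf_marginal y))"
    let ?N = "density sigmaS1 (\<lambda>x. ennreal (leaf_density x y))"
    have eM: "emeasure ?M A = ennreal (measure (K y) A * leaf_marginal y)" if "A \<in> sets borel" for A
      using that K_prob(2)[OF y]
      by (simp add: emeasure_density_const Ky.emeasure_eq_measure ennreal_mult leaf_marginal_nonneg mult.commute)
    have eN: "emeasure ?N A = ennreal (\<integral>x. indicator A x * leaf_density x y \<partial>sigmaS1)" if "A \<in> sets borel" for A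
    proof -
      have [measurable]: "A \<in> sets borel" by fact
      have ia: "integrable sigmaS1 (\<lambda>x. leaf_density x y * indicator A x)"
        by (rule integrable_mult_bounded[OF i, where B=1]) (auto simp: indicator_def)
      have "emeasure ?N A = (\<integral>\<^sup>+x. ennreal (leaf_density x y * indicator A x) \<partial>sigmaS1)"
        by (subst emeasure_density) (auto simp: sets_sigmaS1 indicator_def intro!: nn_integral_cong)
      also have "\<dots> = ennreal (\<integral>x. leaf_density x y * indicator A x \<partial>sigmaS1)"
        using ia by (intro nn_integral_eq_integral) (auto simp: leaf_density_nonneg)
      finally show ?thesis by (simp add: mult.commute)
    qed
    have MN: "?M = ?N"
    proof (rule measure_eqI_rational_rays)
      show "finite_measure ?M"
        using eM[of UNIV] sets_eq_imp_space_eq[OF K_prob(2)[OF y]] by (intro finite_measureI) simp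
      show "emeasure ?M {of_rat s<..} = emeasure ?N {of_rat s<..}" for s
        using r by (simp add: eM eN)
    qed (simp_all add: K_prob(2)[OF y] sets_sigmaS1)
    show "\<forall>A\<in>sets borel. measure (K y) A * leaf_marginal y = (\<integral>x. indicator A x * leaf_density x y \<partial>sigmaS1)"
    proof
      fix A :: "real set" assume A: "A \<in> sets borel"
      have "ennreal (measure (K y) A * leaf_marginal y) = ennreal (\<integral>x. indicator A x * leaf_density x y \<partial>sigmaS1)"
        using MN eM[OF A] eN[OF A] by simp
      moreover have "0 \<le> (\<integral>x. indicator A x * leaf_density x y \<partial>sigmaS1)"
        by (simp add: leaf_density_nonneg)
      ultimately show "measure (K y) A * leaf_marginal y = (\<integral>x. indicator A x * leaf_density x y \<partial>sigmaS1)"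
        by (simp add: leaf_marginal_nonneg)
    qed
  qed
qed

text \<open>The deviation on any set \<open>A\<close> is at most the whole L1 distance; the factor
  1/2 by which the total variation distance is smaller is given away.\<close>

lemma tv_AE: "AE y in torus leaves. tv_dist (K y) sigmaS1 \<le> tv_bound y"
  using posterior_AE leaf_density_AE_integrable AE_space
proof eventually_elim
  fix y
  assume post: "\<forall>A\<in>sets borel. measure (K y) A * leaf_marginal y = (\<integral>x. indicator A x * leaf_density x y \<partial>sigmaS1)"
    and i: "integrable sigmaS1 (\<lambda>x. leaf_density x y)" and "y \<in> space (torus leaves)"
  then have y: "y \<in> extensional leaves" by (simp add: space_torus)
  interpret prob_space sigmaS1 by (rule prob_space_sigmaS1)
  show "tv_dist (K y) sigmaS1 \<le> tv_bound y"
  proof (cases "leaf_marginal y = 0")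
    case True
    then show ?thesis
      using tv_dist_le_1[OF K_prob(1)[OF y] prob_space_sigmaS1] by (simp add: tv_bound_def)
  next
    case False
    then have pos: "leaf_marginal y > 0" using leaf_marginal_nonneg[of y] by simp
    show ?thesis unfolding tv_dist_def
    proof (rule cSUP_least)
      fix A assume "A \<in> sets (K y)"
      then have A: "A \<in> sets borel" by (simp add: K_prob(2)[OF y])
      then have [measurable]: "A \<in> sets sigmaS1" by (simp add: sets_sigmaS1)
      have ia: "integrable sigmaS1 (\<lambda>x. leaf_density x y * indicator A x)"
        by (rule integrable_mult_bounded[OF i, where B=1]) (auto simp: indicator_def)
      have ib: "integrable sigmaS1 (\<lambda>x. leaf_marginal y * indicator A x)"
        by (intro integrable_mult_right integrable_real_indicator) (auto simp: emeasure_eq_measure)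
      have "(measure (K y) A - measure sigmaS1 A) * leaf_marginal y
        = (\<integral>x. leaf_density x y * indicator A x \<partial>sigmaS1) - (\<integral>x. leaf_marginal y * indicator A x \<partial>sigmaS1)"
      proof -
        have "measure (K y) A * leaf_marginal y = (\<integral>x. leaf_density x y * indicator A x \<partial>sigmaS1)"
          using post A by (simp add: mult.commute[of "indicator A _"])
        then show ?thesis by (simp add: left_diff_distrib space_sigmaS1)
      qed
      also have "\<dots> = (\<integral>x. leaf_density x y * indicator A x - leaf_marginal y * indicator A x \<partial>sigmaS1)"
        by (rule Bochner_Integration.integral_diff[OF ia ib, symmetric])
      also have "\<bar>\<dots>\<bar> \<le> (\<integral>x. \<bar>leaf_density x y * indicator A x - leaf_marginal y * indicator A x\<bar> \<partial>sigmaS1)"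
        by (rule integral_abs_bound)
      also have "\<dots> \<le> posterior_gap y"
        unfolding posterior_gap_def
      proof (rule integral_mono)
        show "integrable sigmaS1 (\<lambda>x. \<bar>leaf_density x y * indicator A x - leaf_marginal y * indicator A x\<bar>)"
          by (intro integrable_abs Bochner_Integration.integrable_diff ia ib)
        show "integrable sigmaS1 (\<lambda>x. \<bar>leaf_density x y - leaf_marginal y\<bar>)"
          using i by (intro integrable_abs Bochner_Integration.integrable_diff) auto
      qed (simp add: indicator_def)
      finally have "\<bar>measure (K y) A - measure sigmaS1 A\<bar> * leaf_marginal y \<le> posterior_gap y"
        using pos by (simp add: abs_mult)
      then show "\<bar>measure (K y) A - measure sigmaS1 A\<bar> \<le> tv_bound y"
        using pos by (simp add: tv_bound_def pos_le_divide_eq)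
    qed auto
  qed
qed

lemma expected_tv_bounds:
  assumes "\<epsilon> \<ge> 0" and osc: "\<And>F x x'. F \<in> borel_measurable (torus leaves) \<Longrightarrow> (\<And>y. y \<in> extensional leaves \<Longrightarrow> \<bar>F y\<bar> \<le> 1)
      \<Longrightarrow> \<bar>root_avg q \<beta> k F x - root_avg q \<beta> k F x'\<bar> \<le> \<epsilon>"
  shows "0 \<le> (\<integral>g. tv_dist (K (restrict g leaves)) sigmaS1 \<partial>tree_law q \<beta> k)"
    and "(\<integral>g. tv_dist (K (restrict g leaves)) sigmaS1 \<partial>tree_law q \<beta> k) \<le> \<epsilon>"
proof -
  interpret TL: prob_space "tree_law q \<beta> k" by (rule prob_space_tree_law[OF \<beta>pos])
  interpret product_prob_space "\<lambda>_. sigmaS1" "nodes_upto q k" by (rule product_prob_space_sigmaS1)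
  let ?tv = "\<lambda>g. tv_dist (K (restrict g leaves)) sigmaS1"
  show "0 \<le> (\<integral>g. ?tv g \<partial>tree_law q \<beta> k)"
    by (intro Bochner_Integration.integral_nonneg tv_dist_nonneg K_prob prob_space_sigmaS1) auto
  have L1: "(\<integral>y. \<bar>leaf_density x y - leaf_density x' y\<bar> \<partial>torus leaves) \<le> \<epsilon>" for x x'
    by (rule leaf_density_L1_diff) (rule osc)
  note gap = posterior_gap_bound[OF assms(1) L1]
  have [measurable]: "posterior_gap \<in> borel_measurable (torus leaves)" "leaf_marginal \<in> borel_measurable (torus leaves)"
    using leaf_marginal_integrable posterior_gap_measurable by auto
  have vm: "tv_bound \<in> borel_measurable (torus leaves)"
    unfolding tv_bound_def[abs_def] by measurable
  \<comment> \<open>Null sets pass from the leaves to the tree: under the product measure on all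
    nodes the leaf labels have the product law, and \<open>tree_law\<close> is absolutely continuous
    with respect to that measure.\<close>
  have AE: "AE g in tree_law q \<beta> k. ?tv g \<le> tv_bound (restrict g leaves)"
  proof -
    have "distr (torus (nodes_upto q k)) (torus leaves) (\<lambda>g. restrict g leaves) = torus leaves"
      by (intro distr_PiM_restrict_finite finite_level level_subset)
    then have "AE y in distr (torus (nodes_upto q k)) (torus leaves) (\<lambda>g. restrict g leaves). tv_dist (K y) sigmaS1 \<le> tv_bound y"
      using tv_AE by (simp only:)
    then have "AE g in torus (nodes_upto q k). ?tv g \<le> tv_bound (restrict g leaves)"
      by (rule AE_distrD[OF level_restrict_measurable])
    then show ?thesis
      unfolding tree_law_eq using tree_weight_measurable by (subst AE_density) auto
  qed
  have vle: "(\<integral>g. tv_bound (restrict g leaves) \<partial>tree_law q \<beta> k) \<le> \<epsilon>"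
  proof -
    have "(\<integral>g. tv_bound (restrict g leaves) \<partial>tree_law q \<beta> k) = (\<integral>y. tv_bound y * leaf_marginal y \<partial>torus leaves)"
      using tv_bound_range by (intro expectation_leaves[OF vm, of 3]) auto
    also have "\<dots> \<le> (\<integral>y. posterior_gap y \<partial>torus leaves)"
    proof (rule integral_mono)
      have "integrable (torus leaves) (\<lambda>y. leaf_marginal y * tv_bound y)"
        using tv_bound_range by (intro integrable_mult_bounded[OF leaf_marginal_integrable vm, of 3]) auto
      then show "integrable (torus leaves) (\<lambda>y. tv_bound y * leaf_marginal y)" by (simp add: mult.commute)
      \<comment> \<open>The normalisation \<open>leaf_marginal y\<close> cancels; where it is 0, the
        left side is 0.\<close>
      show "tv_bound y * leaf_marginal y \<le> posterior_gap y" for y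
        by (simp add: tv_bound_def distrib_right posterior_gap_def)
    qed (rule gap(1))
    finally show ?thesis using gap(2) by linarith
  qed
  \<comment> \<open>The total variation distance is not known to be measurable in \<open>g\<close>; if it is not integrable, its
    integral is 0.\<close>
  show "(\<integral>g. ?tv g \<partial>tree_law q \<beta> k) \<le> \<epsilon>"
  proof (cases "integrable (tree_law q \<beta> k) ?tv")
    case True
    have "(\<lambda>g. tv_bound (restrict g leaves)) \<in> borel_measurable (tree_law q \<beta> k)"
      using measurable_compose[OF level_restrict_measurable vm] by (simp add: tree_law_eq)
    then have "integrable (tree_law q \<beta> k) (\<lambda>g. tv_bound (restrict g leaves))"
      using tv_bound_range by (intro TL.integrable_const_bound[where B=3]) auto
    from integral_mono_AE[OF True this AE] vle show ?thesis by linarith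
  next
    case False
    then show ?thesis using assms(1) by (simp add: not_integrable_integral_eq)
  qed
qed

end

end

theorem theorem2:
  fixes q :: nat and \<beta> :: real
    and \<mu> :: "nat \<Rightarrow> (nat list \<Rightarrow> real) \<Rightarrow> real measure"
  assumes "q \<ge> 2" and "\<beta> > 0"
    and "real q * lambda_phi \<beta> < 1"
    and "\<And>k. is_cond_distr (tree_law q \<beta> k) (\<lambda>g. g []) borel
                (\<lambda>g. restrict g (level q k)) (PiM (level q k) (\<lambda>_. borel)) (\<mu> k)"
  shows "(\<lambda>k. \<integral>g. tv_dist (\<mu> k (restrict g (level q k))) sigmaS1 \<partial>tree_law q \<beta> k)
           \<longlonglongrightarrow> 0"
proof -
  let ?C = "2 * pi * normal_density 0 (sqrt \<beta>) 0 * real q"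
  let ?E = "\<lambda>k. \<integral>g. tv_dist (\<mu> k (restrict g (level q k))) sigmaS1 \<partial>tree_law q \<beta> k"
  have r: "0 \<le> real q * lambda_phi \<beta>" by (simp add: lambda_phi_eq[OF assms(2)])
  \<comment> \<open>Depth 0 has no level to smooth and its leaf is the root itself, so the bounds
    start at depth 1; the limit is not affected.\<close>
  have "0 \<le> ?E (Suc k) \<and> ?E (Suc k) \<le> ?C * (real q * lambda_phi \<beta>) ^ k" for k
  proof
    have C: "0 \<le> ?C * (real q * lambda_phi \<beta>) ^ k" using r by simp
    have osc: "\<bar>root_avg q \<beta> (Suc k) F x - root_avg q \<beta> (Suc k) F x'\<bar> \<le> ?C * (real q * lambda_phi \<beta>) ^ k"
      if "F \<in> borel_measurable (torus (level q (Suc k)))"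
        "\<And>y. y \<in> extensional (level q (Suc k)) \<Longrightarrow> \<bar>F y\<bar> \<le> 1" for F x x'
      using root_avg_influence[OF assms(2) that] by simp
    show "0 \<le> ?E (Suc k)"
      by (rule expected_tv_bounds(1)[OF zero_less_Suc assms(2,4) C osc])
    show "?E (Suc k) \<le> ?C * (real q * lambda_phi \<beta>) ^ k"
      by (rule expected_tv_bounds(2)[OF zero_less_Suc assms(2,4) C osc])
  qed
  then have bounds: "0 \<le> ?E (Suc k)" "?E (Suc k) \<le> ?C * (real q * lambda_phi \<beta>) ^ k" for k
    by blast+
  have "(\<lambda>k. ?C * (real q * lambda_phi \<beta>) ^ k) \<longlonglongrightarrow> ?C * 0"
    using r assms(3) by (intro tendsto_mult tendsto_const LIMSEQ_realpow_zero)
  then have "(\<lambda>k. ?C * (real q * lambda_phi \<beta>) ^ k) \<longlonglongrightarrow> 0" by simp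
  then have "(\<lambda>k. ?E (Suc k)) \<longlonglongrightarrow> 0"
    by (rule tendsto_sandwich[OF always_eventually always_eventually tendsto_const, rotated 2]) (intro allI bounds)+
  then show ?thesis by (rule LIMSEQ_imp_Suc)
qed

end
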